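(* Let $d>1$ be a squarefree integer and let $R$ be the ring of integers of $\mathbb{Q}(\sqrt d)\subset\mathbb{R}$. Let $u\in R$ be a unit of norm $-1$ with $u>1$, let $\Delta_n=N_{\mathbb{Q}(\sqrt d)/\mathbb{Q}}(u^n-1)$ for $n\geqslant1$, and let $\Delta'=(\Delta'_k)_{k\geqslant1}$ be the sequence obtained from $\Delta=(\Delta_n)_{n\geqslant1}$ by removing the terms $\Delta_n$ for which $n\equiv2\pmod4$. Then for all $u>13$, $Z(\Delta')\leqslant4$. If $u\leqslant13$, then one of the following is true: (1) $u=1+\sqrt2$, where $Z(\Delta')=3$ and the only term without a primitive prime divisor is $\Delta'_3$; (2) $u=\frac{1+\sqrt5}{2}$, where $Z(\Delta')=18$ and the only terms without a primitive prime divisor are $\Delta'_9$, $\Delta'_{15}$ and $\Delta'_{18}$; (3) $Z(\Delta')=1$.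
   Context: For an integer sequence $A=(a_n)_{n\geqslant1}$, a prime $p$ dividing a term $a_n$ is called a primitive prime divisor of $a_n$ if $p$ does not divide $a_m$ for any $m<n$ with $a_m\neq0$. The Zsigmondy bound of $A$ is $Z(A)=\max\{n: a_n\text{ does not have a primitive prime divisor}\}$ if this set is finite, and $Z(A)=\infty$ otherwise. $N_{\mathbb{Q}(\sqrt d)/\mathbb{Q}}$ denotes the field norm. The terms of $\Delta'$ are indexed consecutively: $\Delta'_1=\Delta_1$, $\Delta'_2=\Delta_3$, $\Delta'_3=\Delta_4$, $\Delta'_4=\Delta_5$, $\Delta'_5=\Delta_7$, and so on; for instance $\Delta'_9=\Delta_{12}$, $\Delta'_{15}=\Delta_{20}$, $\Delta'_{18}=\Delta_{24}$.
   Formalization: In (2) the list of terms without a primitive prime divisor is restricted to indices k>1, because Δ'_1=-1 has no prime divisor and would also belong; when every term has a primitive prime divisor, the undefined maximum of the empty set is taken to be 1, so Z(Δ')=1 in (3) covers that case. *)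

theory Defs
  imports Complex_Main "HOL-Computational_Algebra.Computational_Algebra"
    "HOL-Library.Infinite_Set" "HOL-Library.Extended_Nat"
begin

subsection \<open>Real quadratic fields\<close>

definition quad_field :: "int \<Rightarrow> real set" where
  "quad_field d = {a + b * sqrt (of_int d) | a b. a \<in> \<rat> \<and> b \<in> \<rat>}"

definition quad_integers :: "int \<Rightarrow> real set" where
  "quad_integers d = {x \<in> quad_field d. algebraic_int x}"

definition quad_units :: "int \<Rightarrow> real set" where
  "quad_units d = {u \<in> quad_integers d. \<exists>v \<in> quad_integers d. u * v = 1}"

text \<open>
  The nontrivial automorphism of the field. The rational coordinates \<open>a\<close>, \<open>b\<close> are unique
  if \<open>d > 1\<close> is squarefree; see \<open>quad_conj_eq\<close> below.
\<close>
definition quad_conj :: "int \<Rightarrow> real \<Rightarrow> real" where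
  "quad_conj d x = (THE y. \<exists>a\<in>\<rat>. \<exists>b\<in>\<rat>. x = a + b * sqrt (of_int d) \<and> y = a - b * sqrt (of_int d))"

definition quad_norm :: "int \<Rightarrow> real \<Rightarrow> real" where
  "quad_norm d x = x * quad_conj d x"

text \<open>
  For a unit \<open>u\<close> the norm of \<open>u ^ n - 1\<close> is a rational integer, so that the floor only changes
  the type; see \<open>of_int_Delta\<close> below.
\<close>
definition Delta :: "int \<Rightarrow> real \<Rightarrow> nat \<Rightarrow> int" where
  "Delta d u n = \<lfloor>quad_norm d (u ^ n - 1)\<rfloor>"

text \<open>Sequences are indexed from 1, whereas \<^const>\<open>enumerate\<close> counts from 0.\<close>
definition Delta' :: "int \<Rightarrow> real \<Rightarrow> nat \<Rightarrow> int" where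
  "Delta' d u k = Delta d u (enumerate {n. n \<ge> 1 \<and> n mod 4 \<noteq> 2} (k - 1))"


subsection \<open>Primitive prime divisors and the Zsigmondy bound\<close>

definition primitive_prime_divisor :: "(nat \<Rightarrow> int) \<Rightarrow> nat \<Rightarrow> int \<Rightarrow> bool" where
  "primitive_prime_divisor A n p \<longleftrightarrow>
     prime p \<and> p dvd A n \<and> (\<forall>m. 1 \<le> m \<and> m < n \<and> A m \<noteq> 0 \<longrightarrow> \<not> p dvd A m)"

definition no_primitive :: "(nat \<Rightarrow> int) \<Rightarrow> nat set" where
  "no_primitive A = {n. n \<ge> 1 \<and> \<not> (\<exists>p. primitive_prime_divisor A n p)}"

text \<open>
  The maximum is taken in the index set \<open>{1, 2, 3, \<dots>}\<close>, so that the maximum of the empty set is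
  the least index 1. Hence \<open>Z(A) = 1\<close> says that every term after the first one has a primitive
  prime divisor. The index 1 itself lies in \<open>no_primitive A\<close> iff the first term is 1 or -1, as happens
  for \<open>Delta' 5 ((1 + sqrt 5) / 2)\<close>; lists of exceptional terms of such a sequence therefore have to
  be read as lists of exceptional indices greater than 1.
\<close>
definition zsigmondy_bound :: "(nat \<Rightarrow> int) \<Rightarrow> enat" where
  "zsigmondy_bound A =
     (if \<not> finite (no_primitive A) then \<infinity>
      else if no_primitive A = {} then 1
      else enat (Max (no_primitive A)))"


subsection \<open>Well-definedness\<close>

lemma sqrt_squarefree_irrational:
  assumes "d > 1" "squarefree (d :: int)"
  shows "sqrt (of_int d) \<notin> \<rat>"
proof
  assume "sqrt (of_int d) \<in> \<rat>"
  moreover have "algebraic_int (sqrt (of_int d))"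
    by (intro algebraic_int_sqrt int_imp_algebraic_int) auto
  ultimately obtain k where k: "sqrt (of_int d) = of_int k"
    using rational_algebraic_int_is_int Ints_cases by metis
  have "real_of_int d = of_int (k ^ 2)"
    using k assms(1) by (metis of_int_power real_sqrt_pow2 of_int_0_le_iff less_imp_le zero_less_one
      order_less_trans)
  hence dk: "d = k ^ 2" by linarith
  hence "k dvd 1" using assms(2) unfolding squarefree_def by auto
  hence "d = 1" using dk by (auto simp: zdvd1_eq power2_eq_1_iff abs_if split: if_splits)
  with assms(1) show False by simp
qed

lemma quad_coords_unique:
  assumes "d > 1" "squarefree (d :: int)" "a \<in> \<rat>" "b \<in> \<rat>" "a' \<in> \<rat>" "b' \<in> \<rat>"
    and eq: "a + b * sqrt (of_int d) = a' + b' * sqrt (of_int d)"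
  shows "a = a' \<and> b = b'"
proof -
  have "b = b'"
  proof (rule ccontr)
    assume "b \<noteq> b'"
    hence "sqrt (of_int d) = (a' - a) / (b - b')" using eq by (simp add: field_simps)
    also have "\<dots> \<in> \<rat>" using assms by auto
    finally show False using sqrt_squarefree_irrational assms by blast
  qed
  thus ?thesis using eq by simp
qed

lemma quad_conj_eq:
  assumes "d > 1" "squarefree (d :: int)" "a \<in> \<rat>" "b \<in> \<rat>"
  shows "quad_conj d (a + b * sqrt (of_int d)) = a - b * sqrt (of_int d)"
  unfolding quad_conj_def
proof (rule the_equality)
  show "\<exists>a'\<in>\<rat>. \<exists>b'\<in>\<rat>. a + b * sqrt (of_int d) = a' + b' * sqrt (of_int d) \<and>
          a - b * sqrt (of_int d) = a' - b' * sqrt (of_int d)"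
    using assms by blast
next
  fix y assume "\<exists>a'\<in>\<rat>. \<exists>b'\<in>\<rat>. a + b * sqrt (of_int d) = a' + b' * sqrt (of_int d) \<and>
          y = a' - b' * sqrt (of_int d)"
  thus "y = a - b * sqrt (of_int d)" using quad_coords_unique[OF assms(1,2)] assms(3,4) by metis
qed

lemma quad_norm_eq:
  assumes "d > 1" "squarefree (d :: int)" "a \<in> \<rat>" "b \<in> \<rat>"
  shows "quad_norm d (a + b * sqrt (of_int d)) = a\<^sup>2 - of_int d * b\<^sup>2"
proof -
  have "sqrt (of_int d) * sqrt (of_int d) = real_of_int d" using assms(1) by simp
  thus ?thesis unfolding quad_norm_def quad_conj_eq[OF assms]
    by (simp add: algebra_simps power2_eq_square)
qed

lemma quad_norm_mult:
  assumes "d > 1" "squarefree (d :: int)" "x \<in> quad_field d" "y \<in> quad_field d"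
  shows "x * y \<in> quad_field d" "quad_norm d (x * y) = quad_norm d x * quad_norm d y"
proof -
  define s where "s = sqrt (of_int d)"
  have s: "s * s = real_of_int d" using assms(1) by (simp add: s_def)
  obtain a b where x: "x = a + b * s" and ab: "a \<in> \<rat>" "b \<in> \<rat>"
    using assms(3) by (auto simp: quad_field_def s_def)
  obtain e f where y: "y = e + f * s" and ef: "e \<in> \<rat>" "f \<in> \<rat>"
    using assms(4) by (auto simp: quad_field_def s_def)
  have "b * s * (f * s) = of_int d * b * f" using s by (metis mult.assoc mult.commute)
  hence xy: "x * y = (a * e + of_int d * b * f) + (a * f + b * e) * s"
    by (simp add: x y algebra_simps)
  have r: "a * e + of_int d * b * f \<in> \<rat>" "a * f + b * e \<in> \<rat>" using ab ef by auto
  show "x * y \<in> quad_field d" unfolding xy quad_field_def s_def using r by blast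
  show "quad_norm d (x * y) = quad_norm d x * quad_norm d y"
    unfolding xy unfolding x y s_def quad_norm_eq[OF assms(1,2) r] quad_norm_eq[OF assms(1,2) ab]
      quad_norm_eq[OF assms(1,2) ef]
    by (simp add: algebra_simps power2_eq_square)
qed

lemma quad_norm_power:
  assumes "d > 1" "squarefree (d :: int)" "x \<in> quad_field d"
  shows "x ^ k \<in> quad_field d \<and> quad_norm d (x ^ k) = quad_norm d x ^ k"
proof (induction k)
  case 0
  have "quad_norm d (1 + 0 * sqrt (of_int d)) = 1"
    by (subst quad_norm_eq) (use assms in auto)
  moreover have "1 + 0 * sqrt (of_int d) \<in> quad_field d" unfolding quad_field_def
    using Rats_0 Rats_1 by blast
  ultimately show ?case by simp
qed (use quad_norm_mult[OF assms(1,2,3)] in auto)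

lemma quad_common_denom:
  assumes "\<And>i. i < (m :: nat) \<Longrightarrow> f i \<in> quad_field d"
  shows "\<exists>D :: int. D > 0 \<and> (\<forall>i<m. \<exists>a b :: int. of_int D * f i = of_int a + of_int b * sqrt (of_int d))"
  using assms
proof (induction m)
  case 0
  show ?case by (intro exI[of _ 1]) auto
next
  case (Suc m)
  then obtain D where D: "D > 0"
    "\<forall>i<m. \<exists>a b :: int. of_int D * f i = of_int a + of_int b * sqrt (of_int d)" by auto
  obtain a b where f: "f m = a + b * sqrt (of_int d)" and ab: "a \<in> \<rat>" "b \<in> \<rat>"
    using Suc.prems[of m] by (auto simp: quad_field_def)
  obtain p q where a: "a = of_int p / of_int q" and q: "q > 0" using ab(1) by (rule Rats_cases')
  obtain r t where b: "b = of_int r / of_int t" and t: "t > 0" using ab(2) by (rule Rats_cases')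
  have *: "\<exists>a b :: int. of_int (D * q * t) * f i = of_int a + of_int b * sqrt (of_int d)"
    if i: "i < Suc m" for i
  proof (cases "i = m")
    case True
    have "of_int (D * q * t) * f i = of_int (D * t * p) + of_int (D * q * r) * sqrt (of_int d)"
      using q t by (simp add: True f a b field_simps)
    thus ?thesis by blast
  next
    case False
    then obtain a' b' where "of_int D * f i = of_int a' + of_int b' * sqrt (of_int d)"
      using D i less_SucE by blast
    hence "of_int q * of_int t * (of_int D * f i) =
           of_int (q * t * a') + of_int (q * t * b') * sqrt (of_int d)"
      by (simp add: algebra_simps)
    hence "of_int (D * q * t) * f i = of_int (q * t * a') + of_int (q * t * b') * sqrt (of_int d)"
      by (simp add: mult_ac)
    thus ?thesis by blast
  qed
  show ?case by (rule exI[of _ "D * q * t"]) (use * D q t in auto)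
qed

lemma Rats_bounded_denom_Ints:
  assumes "x \<in> \<rat>" "(D :: int) > 0" "\<And>k. of_int D * x ^ k \<in> (\<int> :: real set)"
  shows "x \<in> \<int>"
proof -
  obtain r s where x: "x = of_int r / of_int s" and s: "s > 0" and co: "coprime r s"
    using assms(1) by (rule Rats_cases')
  have dv: "s ^ k dvd D" for k
  proof -
    obtain z where "of_int D * x ^ k = of_int z" using assms(3)[of k] Ints_cases by blast
    hence "real_of_int (D * r ^ k) = of_int (z * s ^ k)"
      using s by (simp add: x power_divide field_simps)
    hence "D * r ^ k = z * s ^ k" by linarith
    hence "s ^ k dvd D * r ^ k" by simp
    moreover have "coprime (s ^ k) (r ^ k)" using co by (simp add: coprime_commute)
    ultimately show ?thesis by (simp add: coprime_dvd_mult_left_iff)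
  qed
  have "s = 1"
  proof (rule ccontr)
    assume "s \<noteq> 1"
    hence s2: "s \<ge> 2" using s by simp
    have "(2 :: int) ^ nat D \<le> s ^ nat D" using s2 by (intro power_mono) auto
    also have "\<dots> \<le> D" using dv assms(2) by (intro zdvd_imp_le) auto
    also have "D < 2 ^ nat D" using assms(2) of_nat_less_two_power[of "nat D", where 'a = int] by simp
    finally show False by simp
  qed
  thus ?thesis by (simp add: x)
qed

lemma quad_norm_ipoly_Ints:
  assumes d: "d > 1" "squarefree (d :: int)" and u: "u \<in> quad_integers d"
  shows "quad_norm d (poly (map_poly of_int q) u) \<in> \<int>"
proof -
  define s where "s = sqrt (real_of_int d)"
  have uf: "u \<in> quad_field d" and "algebraic_int u" using u by (auto simp: quad_integers_def)
  then obtain P :: "int poly" where P: "poly (map_poly of_int P) u = 0" "lead_coeff P = 1"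
    unfolding algebraic_int_altdef_ipoly by blast
  define m where "m = degree P"
  obtain D :: int where D: "D > 0"
    and D': "\<forall>i<m. \<exists>a b :: int. of_int D * u ^ i = of_int a + of_int b * s"
    using quad_common_denom[of m "\<lambda>i. u ^ i" d] quad_norm_power[OF d uf] unfolding s_def by blast
  define M where "M = {x. \<exists>a b :: int. of_int D * x = of_int a + of_int b * s}"
  have Madd: "x + y \<in> M" if xy: "x \<in> M" "y \<in> M" for x y
  proof -
    obtain a b a' b' where "of_int D * x = of_int a + of_int b * s"
      "of_int D * y = of_int a' + of_int b' * s" using xy unfolding M_def by blast
    hence "of_int D * (x + y) = of_int (a + a') + of_int (b + b') * s" by (simp add: algebra_simps)
    thus ?thesis unfolding M_def by blast
  qed
  have Mmul: "of_int c * x \<in> M" if x: "x \<in> M" for x c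
  proof -
    obtain a b where "of_int D * x = of_int a + of_int b * s" using x unfolding M_def by blast
    hence "of_int c * (of_int D * x) = of_int (c * a) + of_int (c * b) * s"
      by (simp add: algebra_simps)
    hence "of_int D * (of_int c * x) = of_int (c * a) + of_int (c * b) * s" by (simp add: mult_ac)
    thus ?thesis unfolding M_def by blast
  qed
  have M0: "0 \<in> M" unfolding M_def by (auto intro!: exI[of _ 0])
  have Msum: "(\<Sum>i\<in>A. of_int (c i) * g i) \<in> M" if "finite A" "\<And>i. i \<in> A \<Longrightarrow> g i \<in> M"
    for A :: "nat set" and c :: "nat \<Rightarrow> int" and g
    using that by (induction A rule: finite_induct) (auto intro!: M0 Madd Mmul)
  have Mpow: "u ^ k \<in> M" for k
  proof (induction k rule: less_induct)
    case (less k)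
    show ?case
    proof (cases "k < m")
      case True
      thus ?thesis using D' by (simp add: M_def)
    next
      case False
      have "(\<Sum>i\<le>m. of_int (coeff P i) * u ^ i) = 0"
        using P(1) by (simp add: poly_altdef m_def degree_map_poly coeff_map_poly)
      hence "u ^ m = - (\<Sum>i<m. of_int (coeff P i) * u ^ i)"
        using P(2) by (simp add: lessThan_Suc_atMost[symmetric] m_def)
      hence "u ^ k = - (\<Sum>i<m. of_int (coeff P i) * u ^ i) * u ^ (k - m)"
        using False by (metis le_add_diff_inverse not_less power_add)
      also have "\<dots> = (\<Sum>i<m. of_int (- coeff P i) * u ^ (i + (k - m)))"
        by (simp add: sum_distrib_right sum_distrib_left sum_negf power_add mult_ac)
      also have "\<dots> \<in> M" using False by (intro Msum less.IH) auto
      finally show ?thesis .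
    qed
  qed
  define y where "y = poly (map_poly of_int q) u"
  have Mpoly: "poly (map_poly of_int Q) u \<in> M" for Q :: "int poly"
    unfolding poly_altdef by (simp add: coeff_map_poly) (intro Msum Mpow, auto)
  have My: "y ^ k \<in> M" for k
  proof -
    have hom: "map_poly of_int (p * r) = map_poly of_int p * (map_poly of_int r :: real poly)"
      for p r :: "int poly"
      by (intro poly_eqI) (simp add: coeff_map_poly coeff_mult)
    have "y ^ k = poly (map_poly of_int (q ^ k)) u"
      by (induction k) (simp_all add: y_def hom)
    thus ?thesis using Mpoly by simp
  qed
  have Mf: "x \<in> quad_field d \<and> of_int (D ^ 2) * quad_norm d x \<in> \<int>" if x: "x \<in> M" for x
  proof -
    obtain a b where "of_int D * x = of_int a + of_int b * s" using x unfolding M_def by blast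
    hence x: "x = of_int a / of_int D + (of_int b / of_int D) * sqrt (of_int d)"
      using D by (simp add: field_simps s_def)
    have r: "of_int a / of_int D \<in> \<rat>" "of_int b / of_int D \<in> \<rat>" by auto
    have "of_int (D ^ 2) * quad_norm d x = of_int (a ^ 2 - d * b ^ 2)"
      unfolding x quad_norm_eq[OF d r] using D by (simp add: field_simps)
    moreover have "x \<in> quad_field d" unfolding x quad_field_def using r by blast
    ultimately show ?thesis by (metis Ints_of_int)
  qed
  have y: "y \<in> quad_field d" using Mf[of "y ^ 1"] My[of 1] by simp
  then obtain a b where y': "y = a + b * sqrt (of_int d)" and ab: "a \<in> \<rat>" "b \<in> \<rat>"
    by (auto simp: quad_field_def)
  have "quad_norm d y \<in> \<rat>" unfolding y' quad_norm_eq[OF d ab] using ab by auto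
  moreover have "of_int (D ^ 2) * quad_norm d y ^ k \<in> \<int>" for k
    using Mf[OF My[of k]] quad_norm_power[OF d y, of k] by simp
  ultimately have "quad_norm d y \<in> \<int>"
    using D by (metis Rats_bounded_denom_Ints zero_less_power)
  thus ?thesis by (simp add: y_def)
qed

theorem of_int_Delta:
  assumes "d > 1" "squarefree (d :: int)" "u \<in> quad_units d"
  shows "real_of_int (Delta d u n) = quad_norm d (u ^ n - 1)"
proof -
  have "map_poly of_int (monom 1 n - 1 :: int poly) = (monom 1 n - 1 :: real poly)"
    by (intro poly_eqI) (simp add: coeff_map_poly)
  hence "poly (map_poly of_int (monom 1 n - 1 :: int poly)) u = u ^ n - 1"
    by (simp add: poly_monom)
  hence "quad_norm d (u ^ n - 1) \<in> \<int>"
    using quad_norm_ipoly_Ints[OF assms(1,2), of u "monom 1 n - 1"] assms(3)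
    by (simp add: quad_units_def)
  thus ?thesis unfolding Delta_def by (elim Ints_cases) simp
qed

end

theory Submission
  imports Defs "HOL-Number_Theory.Totient"
begin

text \<open>
  Let \<open>a\<close> be the trace of \<open>u\<close>, let \<open>U\<close> be the Lucas sequence \<open>(u ^ n - v ^ n) / (u - v)\<close>, where \<open>v = - 1 / u\<close>
  is the conjugate of \<open>u\<close>, and let \<open>L\<close> be its companion \<open>u ^ n + v ^ n\<close>. Then \<open>\<Delta> n = - L n\<close> for odd \<open>n\<close> and
  \<open>\<Delta> (4 * k) = - (a\<^sup>2 + 4) * U (2 * k) ^ 2\<close>. Hence a prime not dividing \<open>2 * (a\<^sup>2 + 4)\<close> is a primitive
  divisor of \<open>\<Delta> n\<close> as soon as its rank of apparition in \<open>U\<close> is \<open>2 * n\<close> (\<open>n\<close> odd), \<open>n div 4\<close>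
  (\<open>n div 4\<close> odd) or \<open>n div 2\<close> (\<open>n div 4\<close> even), and everything reduces to Carmichael's theorem
  on primitive divisors of \<open>U\<close>.

  The latter follows by estimating the sum of \<open>moebius (m / n) * ln (U n)\<close> over the divisors \<open>n\<close> of \<open>m\<close>,
  the logarithm of the primitive part of \<open>U m\<close>, in two ways. By Binet's formula it is
  at least \<open>totient m * ln u - 2 / 3\<close>. If no prime has rank \<open>m\<close>, then a prime \<open>p\<close> contributes \<open>ln p\<close> if
  \<open>m\<close> is \<open>p ^ k\<close> times the rank of \<open>p\<close>, and nothing otherwise; as the rank is at most \<open>p + 1\<close>,
  this happens for at most one odd prime. The two estimates are incompatible except for a few small \<open>m\<close>.
\<close>

section \<open>Divisors, residues and alternating sums over divisors\<close>

lemma multiplicity_prime_times_other: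
  assumes "prime p" "\<not> p dvd q" "x \<noteq> (0 :: nat)"
  shows "multiplicity p (p * (q * x)) = Suc (multiplicity p x)"
proof -
  have "q \<noteq> 0" using assms(2) by (metis dvd_0_right)
  hence "multiplicity p (p * (q * x)) = Suc (multiplicity p (q * x))"
    using assms by (subst prime_elem_multiplicity_mult_distrib) auto
  thus ?thesis using assms by (simp add: multiplicity_prime_elem_times_other)
qed

lemma dvd_add_cancel: "p dvd x + (y :: nat) \<Longrightarrow> p dvd x \<Longrightarrow> p dvd y"
  by (simp add: dvd_add_right_iff)

text \<open>If every prime factor of \<open>n\<close> lay in \<open>A\<close>, each would occur
  exactly once, so \<open>n\<close> would divide \<open>\<Prod>A\<close>. This yields new prime
  factors of polynomial values without factoring them.\<close>

lemma ex_prime_dvd_notin: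
  fixes n :: nat
  assumes "finite A" "0 \<notin> A" "n > \<Prod>A" "\<And>p. p \<in> A \<Longrightarrow> \<not> p ^ 2 dvd n"
  shows "\<exists>p. prime p \<and> p dvd n \<and> p \<notin> A"
proof (rule ccontr)
  assume neg: "\<not> ?thesis"
  have n0: "n \<noteq> 0" using assms(3) by simp
  have A0: "\<Prod>A \<noteq> 0" using assms(1,2) by simp
  have sub: "prime_factors n \<subseteq> A" using neg by (auto simp: prime_factors_dvd)
  have "n = (\<Prod>p\<in>prime_factors n. p ^ multiplicity p n)" using prod_prime_factors[OF n0] by simp
  also have "\<dots> = \<Prod>(prime_factors n)"
  proof (rule prod.cong[OF refl])
    fix p assume p: "p \<in> prime_factors n"
    hence "multiplicity p n < 2" using assms(4) sub multiplicity_dvd' not_less by blast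
    moreover have "multiplicity p n \<noteq> 0" using p by (simp add: prime_factors_multiplicity)
    ultimately have "multiplicity p n = 1" by linarith
    thus "p ^ multiplicity p n = p" by simp
  qed
  also have "\<dots> dvd \<Prod>A" using sub assms(1) by (intro prod_dvd_prod_subset)
  finally show False using assms(3) A0 by (auto dest: dvd_imp_le)
qed

lemma not_dvd_by_residues:
  fixes f :: "nat \<Rightarrow> nat"
  assumes "\<And>x y. [x = y] (mod k) \<Longrightarrow> [f x = f y] (mod k)" "list_all (\<lambda>r. f r mod k \<noteq> 0) [0..<k]" "k > 0"
  shows "\<not> k dvd f n"
proof -
  have "f n mod k = f (n mod k) mod k"
    using assms(1)[of n "n mod k"] by (simp add: cong_def)
  thus ?thesis using assms(2,3) by (simp add: dvd_eq_mod_eq_0 list_all_iff)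
qed

lemma not_dvd_quadratic:
  assumes "list_all (\<lambda>r. (r\<^sup>2 + c) mod k \<noteq> 0) [0..<k]" "k > 0"
  shows "\<not> k dvd n\<^sup>2 + (c :: nat)"
  using assms by (intro not_dvd_by_residues[of k "\<lambda>n. n\<^sup>2 + c"] cong_add cong_pow cong_refl)

lemma not_dvd_biquadratic:
  assumes "list_all (\<lambda>r. (r ^ 4 + b * r\<^sup>2 + c) mod k \<noteq> 0) [0..<k]" "k > 0"
  shows "\<not> k dvd n ^ 4 + b * n\<^sup>2 + (c :: nat)"
  using assms
  by (intro not_dvd_by_residues[of k "\<lambda>n. n ^ 4 + b * n\<^sup>2 + c"] cong_add cong_mult cong_pow cong_refl)

text \<open>The first three supply the hypothesis on squares in \<open>ex_prime_dvd_notin\<close> at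
  the primes to be avoided. The last one says that 3 is never ramified, since
  \<open>a\<^sup>2 + 4\<close> and \<open>a\<^sup>2 + 1\<close> agree modulo 3.\<close>

lemma residues_quadratic:
  fixes n :: nat
  shows "\<not> 4 dvd n\<^sup>2 + 1" "\<not> 4 dvd n\<^sup>2 + 2" "\<not> 9 dvd n\<^sup>2 + 3" "\<not> 3 dvd n\<^sup>2 + 1"
  by (rule not_dvd_quadratic; simp add: upt_rec[of 0] upt_rec[of "Suc 0"] flip: numeral_2_eq_2)+

lemma residues_biquadratic:
  fixes n :: nat
  shows "\<not> 4 dvd n ^ 4 + 5 * n\<^sup>2 + 5" "\<not> 25 dvd n ^ 4 + 5 * n\<^sup>2 + 5"
    "\<not> 4 dvd n ^ 4 + 4 * n\<^sup>2 + 1" "\<not> 9 dvd n ^ 4 + 4 * n\<^sup>2 + 1"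
  by (rule not_dvd_biquadratic; simp add: upt_rec[of 0] upt_rec[of "Suc 0"] flip: numeral_2_eq_2)+

lemma dvd_10:
  assumes "d dvd (10 :: nat)"
  shows "d \<in> {1, 2, 5, 10}"
proof -
  have "d \<le> 10" using assms by (rule dvd_imp_le) simp
  hence "d = 0 \<or> d = 1 \<or> d = 2 \<or> d = 3 \<or> d = 4 \<or> d = 5 \<or> d = 6 \<or> d = 7 \<or> d = 8 \<or> d = 9 \<or> d = 10"
    by arith
  thus ?thesis using assms by (elim disjE) simp_all
qed

lemma dvd_12:
  assumes "d dvd (12 :: nat)"
  shows "d \<in> {1, 2, 3, 4, 6, 12}"
proof -
  have "d \<le> 12" using assms by (rule dvd_imp_le) simp
  hence "d = 0 \<or> d = 1 \<or> d = 2 \<or> d = 3 \<or> d = 4 \<or> d = 5 \<or> d = 6 \<or> d = 7 \<or> d = 8 \<or> d = 9 \<or> d = 10 \<or> d = 11 \<or> d = 12"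
    by arith
  thus ?thesis using assms by (elim disjE) simp_all
qed

text \<open>This is the sum of \<open>moebius (m / n) * g n\<close> over the divisors \<open>n\<close> of \<open>m\<close>: only squarefree \<open>m / n\<close>
  contribute, and these are the products of the sets of prime factors of \<open>m\<close>.\<close>
definition mobius_sum :: "(nat \<Rightarrow> real) \<Rightarrow> nat \<Rightarrow> real" where
  "mobius_sum g m = (\<Sum>S\<in>Pow (prime_factors m). (-1) ^ card S * g (m div \<Prod>S))"

section \<open>Evaluation and cancellation of Moebius sums\<close>

lemma prod_primes_dvd:
  assumes "finite S" "S \<subseteq> prime_factors (m :: nat)"
  shows "\<Prod>S dvd m"
  using assms
proof (induction S rule: finite_induct)
  case (insert p S)
  have "coprime p (\<Prod>S)"
    using insert by (intro prod_coprime_right) (metis in_prime_factors_imp_prime insert_subset primes_coprime subsetD)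
  thus ?case using insert by (auto intro!: divides_mult)
qed auto

lemma sum_Pow_split:
  assumes "finite Q" "q \<in> Q"
  shows "(\<Sum>S\<in>Pow Q. h S) = (\<Sum>S\<in>Pow (Q - {q}). h S + h (insert q S))"
proof -
  have "Pow Q = Pow (Q - {q}) \<union> insert q ` Pow (Q - {q})"
    using assms(2) Pow_insert[of q "Q - {q}"] by (simp add: insert_absorb)
  hence "(\<Sum>S\<in>Pow Q. h S) = (\<Sum>S\<in>Pow (Q - {q}). h S) + (\<Sum>S\<in>insert q ` Pow (Q - {q}). h S)"
    using assms(1) by (simp only:) (intro sum.union_disjoint; auto)
  also have "(\<Sum>S\<in>insert q ` Pow (Q - {q}). h S) = (\<Sum>S\<in>Pow (Q - {q}). h (insert q S))"
    by (subst sum.reindex) (auto simp: inj_on_def)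
  finally show ?thesis by (simp add: sum.distrib)
qed

text \<open>Pairing each set \<open>S\<close> avoiding \<open>q\<close> with
  \<open>insert q S\<close>, whose sign is opposite, exposes the cancellation used below.\<close>

lemma mobius_sum_split:
  assumes "q \<in> prime_factors m"
  shows "mobius_sum g m = (\<Sum>S\<in>Pow (prime_factors m - {q}).
    (-1) ^ card S * (g (m div \<Prod>S) - g (m div \<Prod>S div q)))"
proof -
  have *: "card (insert q S) = Suc (card S)" "\<Prod>(insert q S) = \<Prod>S * q"
    if "S \<in> Pow (prime_factors m - {q})" for S
  proof -
    have "finite S" "q \<notin> S" using that finite_subset[of S "prime_factors m"] by auto
    thus "card (insert q S) = Suc (card S)" "\<Prod>(insert q S) = \<Prod>S * q" by auto
  qed
  show ?thesis unfolding mobius_sum_def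
    by (subst sum_Pow_split[OF _ assms], simp, intro sum.cong refl)
       (simp only: * div_mult2_eq, simp add: algebra_simps)
qed

text \<open>Translates a set of primes avoiding \<open>q\<close> into a divisor \<open>n\<close> of
  \<open>m\<close> whose cofactor is prime to \<open>q\<close>, so that later cancellation
  conditions speak of divisors only.\<close>

lemma mobius_quotient:
  fixes m q :: nat
  assumes "m > 0" "prime q" "S \<subseteq> prime_factors m - {q}"
  shows "m div \<Prod>S dvd m" "\<not> q dvd m div (m div \<Prod>S)" "m div (m div \<Prod>S) = \<Prod>S"
proof -
  have fin: "finite S" using assms(3) finite_subset by blast
  have dvd: "\<Prod>S dvd m" by (rule prod_primes_dvd[OF fin]) (use assms(3) in blast)
  thus "m div \<Prod>S dvd m" by (metis dvd_div_mult_self dvd_triv_left)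
  show eq: "m div (m div \<Prod>S) = \<Prod>S" using dvd assms(1) by (auto elim!: dvdE)
  show "\<not> q dvd m div (m div \<Prod>S)"
    unfolding eq prime_dvd_prod_iff[OF fin assms(2)]
    using assms(2,3) by (metis Diff_iff in_prime_factors_imp_prime primes_dvd_imp_eq singletonI subsetD)
qed

text \<open>All pairs in \<open>mobius_sum_split\<close> cancel except that of the empty set, which
  belongs to \<open>n = m\<close>.\<close>

lemma mobius_sum_eq_single:
  assumes "m > 0" "q \<in> prime_factors m"
    and "\<And>n. n dvd m \<Longrightarrow> n \<noteq> m \<Longrightarrow> \<not> q dvd m div n \<Longrightarrow> g n = g (n div q)"
  shows "mobius_sum g m = g m - g (m div q)"
proof -
  have "(-1) ^ card S * (g (m div \<Prod>S) - g (m div \<Prod>S div q)) = 0"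
    if S: "S \<in> Pow (prime_factors m - {q}) - {{}}" for S
  proof -
    have fin: "finite S" using S finite_subset by blast
    note mq = mobius_quotient[of m q S]
    have "prime q" using assms(2) by blast
    have "m div \<Prod>S \<noteq> m"
    proof
      assume "m div \<Prod>S = m"
      hence "\<Prod>S = 1" using mq(3) assms(1) \<open>prime q\<close> S by auto
      moreover obtain p where "p \<in> S" using S by blast
      ultimately have "p dvd 1" using dvd_prodI[OF fin, of p "\<lambda>x. x"] by simp
      moreover have "prime p" using \<open>p \<in> S\<close> S by blast
      ultimately show False by (simp add: prime_nat_iff)
    qed
    thus ?thesis using assms(3)[of "m div \<Prod>S"] mq assms(1) \<open>prime q\<close> S by auto
  qed
  hence "mobius_sum g m = (\<Sum>S\<in>{{}}. (-1) ^ card S * (g (m div \<Prod>S) - g (m div \<Prod>S div q)))"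
    unfolding mobius_sum_split[OF assms(2)] by (intro sum.mono_neutral_right) auto
  thus ?thesis by simp
qed

lemma mobius_sum_eq_0:
  assumes "m > 0" "q \<in> prime_factors m"
    and "\<And>n. n dvd m \<Longrightarrow> \<not> q dvd m div n \<Longrightarrow> g n = g (n div q)"
  shows "mobius_sum g m = 0"
proof -
  have "prime q" using assms(2) by blast
  hence "\<not> q dvd m div m" using assms(1) by (auto dest: not_prime_unit)
  hence "g m = g (m div q)" by (intro assms(3)) auto
  thus ?thesis using mobius_sum_eq_single[OF assms(1,2), of g] assms(3) by simp
qed

lemma mobius_sum_cong:
  assumes "\<And>n. n dvd m \<Longrightarrow> n > 0 \<Longrightarrow> g n = h n" "m > 0"
  shows "mobius_sum g m = mobius_sum h m"
proof -
  have "g (m div \<Prod>S) = h (m div \<Prod>S)" if "S \<in> Pow (prime_factors m)" for S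
  proof -
    have "\<Prod>S dvd m" using that by (intro prod_primes_dvd) (auto intro: finite_subset)
    thus ?thesis using assms by (intro assms(1)) (auto elim!: dvdE)
  qed
  thus ?thesis unfolding mobius_sum_def by (intro sum.cong) auto
qed

lemma mobius_sum_add: "mobius_sum (\<lambda>n. g n + h n) m = mobius_sum g m + mobius_sum h m"
  by (simp add: mobius_sum_def algebra_simps sum.distrib)

lemma mobius_sum_cmult: "mobius_sum (\<lambda>n. g n * c) m = mobius_sum g m * c"
  unfolding mobius_sum_def sum_distrib_right by (simp only: mult.assoc)

lemma mobius_sum_sum: "mobius_sum (\<lambda>n. \<Sum>p\<in>A. f p n) m = (\<Sum>p\<in>A. mobius_sum (f p) m)"
  unfolding mobius_sum_def sum_distrib_left by (rule sum.swap)

lemma mobius_sum_const: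
  assumes "m > 1"
  shows "mobius_sum (\<lambda>_. c) m = 0"
proof -
  obtain q where "prime q" "q dvd m" using assms by (metis less_numeral_extra(4) prime_factor_nat)
  thus ?thesis using assms by (intro mobius_sum_eq_0[of m q]) (auto simp: prime_factors_dvd)
qed

text \<open>Multiplying out Euler's product for the totient gives exactly this alternating
  sum.\<close>

lemma mobius_sum_real:
  assumes "m > 0"
  shows "mobius_sum real m = real (totient m)"
proof -
  have "real (totient m) = real m * (\<Sum>S\<in>Pow (prime_factors m). (-1) ^ card S * (\<Prod>p\<in>S. 1 / real p))"
    unfolding totient_formula2 by (subst prod_diff_conv_sum) auto
  also have "\<dots> = mobius_sum real m"
    unfolding mobius_sum_def sum_distrib_left
  proof (intro sum.cong refl)
    fix S assume S: "S \<in> Pow (prime_factors m)"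
    hence "\<Prod>S dvd m" by (intro prod_primes_dvd) (auto intro: finite_subset)
    thus "real m * ((-1) ^ card S * (\<Prod>p\<in>S. 1 / real p)) = (-1) ^ card S * real (m div \<Prod>S)"
      by (simp add: real_of_nat_div prod_dividef)
  qed
  finally show ?thesis by simp
qed

text \<open>Distinct sets of primes have distinct products, so the arguments
  \<open>m div \<Prod>S\<close> are distinct elements of \<open>{1..m}\<close>.\<close>

lemma mobius_sum_abs_le:
  assumes "m > 0" "\<And>n. n > 0 \<Longrightarrow> \<bar>g n\<bar> \<le> h n"
  shows "\<bar>mobius_sum g m\<bar> \<le> (\<Sum>n\<in>{1..m}. h n)"
proof -
  let ?Q = "Pow (prime_factors m)"
  have dvd: "\<Prod>S dvd m" if "S \<in> ?Q" for S
    using that by (intro prod_primes_dvd) (auto intro: finite_subset)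
  have range: "m div \<Prod>S \<in> {1..m}" if "S \<in> ?Q" for S
    using dvd[OF that] assms(1) by (auto elim!: dvdE simp: Suc_le_eq)
  have "inj_on Prod ?Q"
    by (intro inj_on_Prod_primes) (auto intro: finite_subset)
  moreover have "inj_on (\<lambda>d. m div d) {d. d dvd m}"
    using assms(1) by (auto simp: inj_on_def) (metis div_mult_self_is_m dvd_def mult.commute nat_0_less_mult_iff)
  ultimately have inj: "inj_on (\<lambda>S. m div \<Prod>S) ?Q"
    using dvd unfolding inj_on_def by blast
  have "\<bar>mobius_sum g m\<bar> \<le> (\<Sum>S\<in>?Q. \<bar>(-1) ^ card S * g (m div \<Prod>S)\<bar>)"
    unfolding mobius_sum_def by (rule sum_abs)
  also have "\<dots> \<le> (\<Sum>S\<in>?Q. h (m div \<Prod>S))"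
    using range by (intro sum_mono) (auto simp: abs_mult intro!: assms(2) simp: Suc_le_eq)
  also have "\<dots> = (\<Sum>n\<in>(\<lambda>S. m div \<Prod>S) ` ?Q. h n)"
    by (subst sum.reindex[OF inj]) simp
  also have "\<dots> \<le> (\<Sum>n\<in>{1..m}. h n)"
    using range assms(2) order.trans[OF abs_ge_zero assms(2)] by (intro sum_mono2) (auto simp: Suc_le_eq)
  finally show ?thesis .
qed

lemma ln_prime_decomposition:
  assumes "n > (0 :: nat)" "finite A" "prime_factors n \<subseteq> A" "\<And>p. p \<in> A \<Longrightarrow> prime p"
  shows "ln (real n) = (\<Sum>p\<in>A. real (multiplicity p n) * ln (real p))"
proof -
  have pos: "p > 0" if "p \<in> prime_factors n" for p
    using that in_prime_factors_imp_prime prime_gt_0_nat by blast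
  have "real n = real (\<Prod>p\<in>prime_factors n. p ^ multiplicity p n)"
    using prod_prime_factors[of n] assms(1) by simp
  hence "ln (real n) = ln (\<Prod>p\<in>prime_factors n. real p ^ multiplicity p n)" by simp
  also have "\<dots> = (\<Sum>p\<in>prime_factors n. ln (real p ^ multiplicity p n))"
    by (rule ln_prod) (simp_all add: pos)
  also have "\<dots> = (\<Sum>p\<in>prime_factors n. real (multiplicity p n) * ln (real p))"
    by (intro sum.cong refl ln_realpow)
  also have "\<dots> = (\<Sum>p\<in>A. real (multiplicity p n) * ln (real p))"
    using assms by (intro sum.mono_neutral_left) (auto simp: prime_factors_multiplicity)
  finally show ?thesis .
qed

section \<open>The Lucas sequence and its companion\<close>

locale lucas =
  fixes a :: nat
  assumes a_pos: "a > 0"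
begin

fun U :: "nat \<Rightarrow> nat" where
  "U 0 = 0"
| "U (Suc 0) = 1"
| "U (Suc (Suc n)) = a * U (Suc n) + U n"

definition L :: "nat \<Rightarrow> nat" where
  "L n = (if n = 0 then 2 else U (Suc n) + U (n - 1))"

lemma U_pos: "n > 0 \<Longrightarrow> U n > 0"
  by (induction n rule: U.induct) (use a_pos in auto)

lemma U_eq_0_iff [simp]: "U n = 0 \<longleftrightarrow> n = 0"
  using U_pos[of n] by (cases n) auto

lemma L_pos: "L n > 0"
  by (auto simp: L_def U_pos)

lemma L_Suc: "L (Suc n) = 2 * U n + a * U (Suc n)"
  by (simp add: L_def)

lemma U_add: "U (i + Suc j) = U (Suc i) * U (Suc j) + U i * U j"
proof (induction i rule: U.induct)
  case (3 i)
  have "U (Suc (Suc i) + Suc j) = a * U (Suc i + Suc j) + U (i + Suc j)" by simp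
  thus ?case unfolding 3 by (simp add: algebra_simps)
qed auto

text \<open>d'Ocagne's identity. Modulo a prime, it turns equal ratios of consecutive terms at two
  indices into divisibility of the term at the difference of the indices.\<close>

lemma U_cross: "int (U (Suc i)) * int (U (i + t)) - int (U (Suc (i + t))) * int (U i) = (-1) ^ i * int (U t)"
proof (induction i)
  case (Suc i)
  have "int (U (Suc (Suc i))) * int (U (Suc i + t)) - int (U (Suc (Suc i + t))) * int (U (Suc i)) =
    - (int (U (Suc i)) * int (U (i + t)) - int (U (Suc (i + t))) * int (U i))"
    by (simp add: algebra_simps)
  thus ?case using Suc by simp
qed auto

lemma coprime_U_Suc: "coprime (U (Suc n)) (U n)"
proof (induction n)
  case (Suc n)
  have "gcd (U (Suc (Suc n))) (U (Suc n)) = gcd (U n) (U (Suc n))"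
    using gcd_add_mult[of "U (Suc n)" a "U n"] by (simp add: gcd.commute)
  thus ?case using Suc by (simp add: coprime_iff_gcd_eq_1 gcd.commute)
qed auto

lemma U_dvd: "k dvd n \<Longrightarrow> U k dvd U n"
proof (elim dvdE)
  fix c assume n: "n = k * c"
  have "U k dvd U (k * c)"
  proof (cases k)
    case (Suc j)
    show ?thesis
    proof (induction c)
      case (Suc c)
      have "k * Suc c = k * c + Suc j" by (simp add: \<open>k = Suc j\<close>)
      thus ?case using Suc by (simp only: U_add) (auto simp: \<open>k = Suc j\<close> intro!: dvd_add)
    qed auto
  qed auto
  thus "U k dvd U n" by (simp add: n)
qed

section \<open>Binet's formulas and their consequences\<close>

definition \<alpha> :: real where "\<alpha> = (a + sqrt (a\<^sup>2 + 4)) / 2"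
definition \<beta> :: real where "\<beta> = (a - sqrt (a\<^sup>2 + 4)) / 2"

lemma \<alpha>_times_\<beta>: "\<alpha> * \<beta> = -1"
  and \<alpha>_plus_\<beta>: "\<alpha> + \<beta> = a"
  and \<alpha>_minus_\<beta>: "\<alpha> - \<beta> = sqrt (a\<^sup>2 + 4)"
  by (auto simp: \<alpha>_def \<beta>_def field_simps power2_eq_square)

lemma \<alpha>_square: "\<alpha>\<^sup>2 = a * \<alpha> + 1"
  using \<alpha>_plus_\<beta> \<alpha>_times_\<beta> by (simp add: algebra_simps power2_eq_square flip: \<alpha>_plus_\<beta>)

lemma \<beta>_square: "\<beta>\<^sup>2 = a * \<beta> + 1"
  using \<alpha>_plus_\<beta> \<alpha>_times_\<beta> by (simp add: algebra_simps power2_eq_square flip: \<alpha>_plus_\<beta>)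

text \<open>The worst case is \<open>a = 1\<close>; \<open>809 / 500\<close> is a rational lower
  bound for the golden ratio, sharp enough for all later numerics.\<close>

lemma \<alpha>_ge: "\<alpha> \<ge> 809 / 500"
proof -
  have "sqrt 5 \<le> sqrt (a\<^sup>2 + 4)"
    using a_pos by (intro real_sqrt_le_mono) (simp add: Suc_leI flip: of_nat_power)
  moreover have "559 / 250 \<le> sqrt (5::real)" by (rule real_le_rsqrt) (simp add: power2_eq_square)
  moreover have "1 \<le> real a" using a_pos by simp
  ultimately have "1 + 559 / 250 \<le> real a + sqrt (a\<^sup>2 + 4)" by linarith
  thus ?thesis by (simp add: \<alpha>_def)
qed

lemma \<alpha>_pos: "\<alpha> > 0"
  using \<alpha>_ge by linarith

lemma U_Binet: "(\<alpha> - \<beta>) * real (U n) = \<alpha> ^ n - \<beta> ^ n"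
proof (induction n rule: U.induct)
  case (3 n)
  have "(\<alpha> - \<beta>) * real (U (Suc (Suc n))) = a * (\<alpha> ^ Suc n - \<beta> ^ Suc n) + (\<alpha> ^ n - \<beta> ^ n)"
    unfolding 3[symmetric] by (simp add: algebra_simps)
  also have "\<dots> = \<alpha> ^ n * (a * \<alpha> + 1) - \<beta> ^ n * (a * \<beta> + 1)" by (simp add: algebra_simps)
  also have "\<dots> = \<alpha> ^ Suc (Suc n) - \<beta> ^ Suc (Suc n)"
    unfolding \<alpha>_square[symmetric] \<beta>_square[symmetric] by (simp add: power2_eq_square)
  finally show ?case .
qed auto

lemma \<alpha>_gt_\<beta>: "\<alpha> - \<beta> > 0"
  unfolding \<alpha>_minus_\<beta> by (simp add: add_nonneg_pos)

lemma L_Binet: "real (L n) = \<alpha> ^ n + \<beta> ^ n"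
proof (cases n)
  case (Suc k)
  have "(\<alpha> - \<beta>) * real (L n) = 2 * (\<alpha> ^ k - \<beta> ^ k) + (\<alpha> + \<beta>) * (\<alpha> ^ Suc k - \<beta> ^ Suc k)"
    unfolding U_Binet[symmetric] \<alpha>_plus_\<beta> by (simp add: Suc L_Suc algebra_simps)
  also have "\<dots> = (\<alpha> - \<beta>) * (\<alpha> ^ n + \<beta> ^ n) + 2 * (1 + \<alpha> * \<beta>) * (\<alpha> ^ k - \<beta> ^ k)"
    by (simp add: Suc algebra_simps)
  finally show ?thesis using \<alpha>_gt_\<beta> by (simp add: \<alpha>_times_\<beta>)
qed (simp add: L_def)

lemma U_double: "U (2 * n) = U n * L n"
proof -
  have "(\<alpha> - \<beta>) * real (U (2 * n)) = (\<alpha> - \<beta>) * real (U n * L n)"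
    by (simp add: U_Binet L_Binet flip: mult.assoc) (simp add: algebra_simps flip: power_add mult_2)
  thus ?thesis using \<alpha>_gt_\<beta> by (simp del: of_nat_mult)
qed

text \<open>Square Binet's formula for \<open>U n\<close> and use
  \<open>\<alpha> * \<beta> = -1\<close>.\<close>

lemma L_double: "int (L (2 * n)) = (int a ^ 2 + 4) * int (U n) ^ 2 + 2 * (-1) ^ n"
proof -
  have "real (L (2 * n)) = ((\<alpha> - \<beta>) * real (U n)) ^ 2 + 2 * (\<alpha> * \<beta>) ^ n"
    unfolding U_Binet L_Binet
    by (simp add: power2_diff mult.commute[of 2 n] power_mult_distrib flip: power_mult)
  also have "\<dots> = (real a ^ 2 + 4) * real (U n) ^ 2 + 2 * (-1) ^ n"
    unfolding power_mult_distrib \<alpha>_minus_\<beta> \<alpha>_times_\<beta> by simp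
  also have "\<dots> = of_int ((int a ^ 2 + 4) * int (U n) ^ 2 + 2 * (-1) ^ n)" by simp
  finally show ?thesis by (metis of_int_eq_iff of_int_of_nat_eq)
qed

text \<open>For positive \<open>n\<close>, \<open>L n = 2 * U (n - 1) + a * U n\<close>, and
  consecutive terms of \<open>U\<close> are coprime.\<close>

lemma prime_dvd_U_L:
  assumes "prime p" "p dvd U n" "p dvd L n"
  shows "p = 2"
proof (cases n)
  case (Suc k)
  have "p dvd 2 * U k" using assms(2,3) Suc dvd_add_left_iff[of p "a * U n" "2 * U k"] by (simp add: L_Suc)
  moreover have "\<not> p dvd U k"
    using assms(1,2) Suc coprime_U_Suc[of k] by (metis coprime_common_divisor_nat not_prime_1)
  ultimately show ?thesis using assms(1) by (metis prime_dvd_mult_iff primes_dvd_imp_eq two_is_prime_nat)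
next
  case 0
  thus ?thesis using assms by (auto simp: L_def primes_dvd_imp_eq)
qed

text \<open>With \<open>w = U (k - 1)\<close> one has \<open>\<alpha> ^ k = U k * \<alpha> + w\<close>; this is the binomial expansion of its powers
  modulo \<open>U k ^ 3\<close>.\<close>
lemma U_multiple:
  "\<exists>s. U ((q + 2) * Suc k) = (q + 2) * U (Suc k) * U k ^ (q + 1)
        + a * ((q + 2) choose 2) * U (Suc k) ^ 2 * U k ^ q + U (Suc k) ^ 3 * s"
proof -
  \<comment> \<open>\<open>U_add\<close> involves the next term as well, so its expansion modulo
    \<open>U (Suc k) ^ 2\<close> is carried through the induction.\<close>
  have "\<exists>s t. U ((q + 2) * Suc k) = (q + 2) * U (Suc k) * U k ^ (q + 1)
        + a * ((q + 2) choose 2) * U (Suc k) ^ 2 * U k ^ q + U (Suc k) ^ 3 * s \<and>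
      U (Suc ((q + 2) * Suc k)) = a * U ((q + 2) * Suc k) + U k ^ (q + 2) + U (Suc k) ^ 2 * t"
  proof (induction q)
    case 0
    have e: "(0 + 2) * Suc k = Suc k + Suc k" by simp
    have "U (Suc (Suc k + Suc k)) = U (Suc (Suc k)) * U (Suc (Suc k)) + U (Suc k) * U (Suc k)"
      using U_add[of "Suc k" "Suc k"] by simp
    hence "U (Suc (Suc k + Suc k)) = a * U (Suc k + Suc k) + U k ^ 2 + U (Suc k) ^ 2 * 1"
      unfolding U_add by (simp add: algebra_simps power2_eq_square)
    moreover have "U (Suc k + Suc k) = 2 * U (Suc k) * U k + a * U (Suc k) ^ 2"
      unfolding U_add by (simp add: algebra_simps power2_eq_square)
    ultimately show ?case unfolding e
      by (intro exI[of _ 0] exI[of _ 1]) (simp add: choose_two flip: power2_eq_square)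
  next
    case (Suc q)
    define n where "n = (q + 2) * Suc k"
    define x w where "x = U (Suc k)" and "w = U k"
    define c where "c = ((q + 2) choose 2)"
    have ch: "(Suc q + 2 choose 2) = c + (q + 2)"
      by (simp add: c_def numeral_2_eq_2)
    obtain s t where st: "U n = (q + 2) * x * w ^ (q + 1) + a * c * x ^ 2 * w ^ q + x ^ 3 * s"
      "U (Suc n) = a * U n + w ^ (q + 2) + x ^ 2 * t"
      using Suc unfolding n_def x_def w_def c_def by blast
    have e: "(Suc q + 2) * Suc k = n + Suc k" by (simp add: n_def)
    have 1: "U (n + Suc k) = (a * U n + w ^ (q + 2) + x ^ 2 * t) * x + U n * w"
      unfolding U_add st(2)[symmetric] by (simp add: x_def w_def)
    also have "\<dots> = (Suc q + 2) * x * w ^ (Suc q + 1)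
        + a * (c + (q + 2)) * x ^ 2 * w ^ Suc q + x ^ 3 * (a * a * c * w ^ q + a * x * s + t + s * w)"
      unfolding st(1) by (simp add: algebra_simps power2_eq_square power3_eq_cube)
    finally have U: "U (n + Suc k) = \<dots>" .
    have "U (Suc (n + Suc k)) = U (Suc n) * U (Suc (Suc k)) + U n * U (Suc k)"
      using U_add[of n "Suc k"] by simp
    also have "\<dots> = (a * U n + w ^ (q + 2) + x ^ 2 * t) * (a * x + w) + U n * x"
      unfolding st(2)[symmetric] by (simp add: x_def w_def)
    also have "\<dots> = a * U (n + Suc k) + w ^ (Suc q + 2) + x ^ 2 * (t * w) + x * U n"
      unfolding 1 by (simp add: algebra_simps power2_eq_square)
    also have "x * U n = x ^ 2 * ((q + 2) * w ^ (q + 1) + a * c * x * w ^ q + x ^ 2 * s)"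
      unfolding st(1) by (simp add: algebra_simps power2_eq_square power3_eq_cube)
    also have "a * U (n + Suc k) + w ^ (Suc q + 2) + x ^ 2 * (t * w) + \<dots> =
      a * U (n + Suc k) + w ^ (Suc q + 2) + x ^ 2 *
        (t * w + ((q + 2) * w ^ (q + 1) + a * c * x * w ^ q + x ^ 2 * s))"
      by (simp add: algebra_simps)
    finally show ?case unfolding e ch using U unfolding x_def w_def by blast
  qed
  thus ?thesis by blast
qed

section \<open>Ranks of apparition\<close>

lemma prime_not_dvd_U_pred:
  assumes "prime p" "p dvd U (Suc k)"
  shows "\<not> p dvd U k"
  using assms coprime_U_Suc[of k] by (metis coprime_common_divisor_nat not_prime_1)

text \<open>Modulo \<open>U k\<close> the quotient \<open>U (q * k) / U k\<close> is
  \<open>q * U (k - 1) ^ (q - 1)\<close>, which is prime to \<open>p\<close>.\<close>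

lemma multiplicity_U_times_other:
  assumes "prime p" "p dvd U k" "k > 0" "\<not> p dvd q"
  shows "multiplicity p (U (q * k)) = multiplicity p (U k)"
proof -
  obtain j where k: "k = Suc j" using assms(3) gr0_implies_Suc by blast
  consider "q = 0" | "q = 1" | r where "q = r + 2"
    by (metis One_nat_def add_2_eq_Suc' not0_implies_Suc)
  thus ?thesis
  proof cases
    case 3
    obtain s where s: "U (q * k) = q * U k * U j ^ (r + 1) + a * (q choose 2) * U k ^ 2 * U j ^ r + U k ^ 3 * s"
      using U_multiple[of r j] unfolding 3 k by blast
    define y where "y = a * (q choose 2) * U j ^ r + U k * s"
    have "U (q * k) = (q * U j ^ (r + 1) + U k * y) * U k"
      unfolding s y_def by (simp add: algebra_simps power2_eq_square power3_eq_cube)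
    moreover have "\<not> p dvd q * U j ^ (r + 1) + U k * y"
    proof
      assume "p dvd q * U j ^ (r + 1) + U k * y"
      hence "p dvd q * U j ^ (r + 1)" using assms(2) dvd_add_left_iff dvd_mult2 by blast
      hence "p dvd U j" using assms(1,4) prime_dvd_mult_iff prime_dvd_power by blast
      thus False using prime_not_dvd_U_pred assms(1,2) k by blast
    qed
    ultimately show ?thesis using assms(1) by (simp add: multiplicity_prime_elem_times_other)
  qed (use assms in auto)
qed

text \<open>Oddness makes \<open>p choose 2\<close> a multiple of \<open>p\<close>. After the factor
  \<open>p * U k\<close> is removed from the expansion, only the term
  \<open>U (k - 1) ^ (p - 1)\<close> is not divisible by \<open>p\<close>.\<close>

lemma multiplicity_U_times_odd_prime:
  assumes "prime p" "odd p" "p dvd U k" "k > 0"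
  shows "multiplicity p (U (p * k)) = Suc (multiplicity p (U k))"
proof -
  obtain j where k: "k = Suc j" using assms(4) gr0_implies_Suc by blast
  have p2: "p \<ge> 2" using assms(1) prime_ge_2_nat by blast
  define r where "r = p - 2"
  have p: "p = r + 2" using p2 by (simp add: r_def)
  obtain s where s: "U (p * k) = p * U k * U j ^ (r + 1) + a * (p choose 2) * U k ^ 2 * U j ^ r + U k ^ 3 * s"
    using U_multiple[of r j] unfolding p k by blast
  obtain h where h: "p - 1 = 2 * h" using assms(2) by (metis dvd_def odd_two_times_div_two_nat)
  have ch: "p choose 2 = p * h" unfolding choose_two h by simp
  obtain x where x: "U k = p * x" using assms(3) by blast
  define y where "y = a * h * U j ^ r + x * s"
  have "U (p * k) = p * ((U j ^ (r + 1) + U k * y) * U k)"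
    unfolding s ch y_def by (simp add: x algebra_simps power2_eq_square power3_eq_cube)
  moreover have "\<not> p dvd U j ^ (r + 1) + U k * y"
  proof
    assume "p dvd U j ^ (r + 1) + U k * y"
    hence "p dvd U j ^ (r + 1)" using assms(3) dvd_add_left_iff dvd_mult2 by blast
    hence "p dvd U j" using assms(1) prime_dvd_power by blast
    thus False using prime_not_dvd_U_pred assms(1,3) k by blast
  qed
  ultimately show ?thesis using assms(1,4) multiplicity_prime_times_other[of p _ "U k"] by simp
qed

text \<open>\<open>L_double\<close> with \<open>U i\<close> even makes \<open>L (2 * i)\<close>
  twice an odd number. The doubling from \<open>i\<close> to \<open>2 * i\<close> is not covered, as
  \<open>L i\<close> can be divisible by 4: for instance \<open>a = 1\<close>,
  \<open>i = 3\<close>.\<close>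

lemma multiplicity_2_U:
  assumes "even (U i)" "i > 0"
  shows "multiplicity 2 (U (2 * (2 * i))) = Suc (multiplicity 2 (U (2 * i)))"
proof -
  obtain x where x: "U i = 2 * x" using assms(1) by blast
  have "int (L (2 * i)) = 2 * (2 * ((int a ^ 2 + 4) * int x ^ 2) + (-1) ^ i)"
    unfolding L_double x by (simp add: power2_eq_square algebra_simps)
  moreover have "odd (2 * ((int a ^ 2 + 4) * int x ^ 2) + (-1) ^ i)" by simp
  ultimately obtain z where z: "int (L (2 * i)) = 2 * z" "odd z" by blast
  hence "L (2 * i) = 2 * nat z" "odd (nat z)" by (auto simp: even_nat_iff)
  hence "U (2 * (2 * i)) = 2 * (nat z * U (2 * i))" "\<not> 2 dvd nat z" unfolding U_double[of "2 * i"] by auto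
  thus ?thesis using assms(2) multiplicity_prime_times_other[of 2 "nat z" "U (2 * i)"] by simp
qed

definition apparition :: "nat \<Rightarrow> nat" where
  "apparition p = (LEAST r. r > 0 \<and> p dvd U r)"

text \<open>If \<open>p\<close> divided none of these terms, the ratios
  \<open>U (i + 1) / U i\<close> modulo \<open>p\<close> at \<open>p + 1\<close> indices would take
  at most \<open>p\<close> values; two equal ratios give \<open>p dvd U (j - i)\<close> by
  \<open>U_cross\<close>.\<close>

lemma apparition_le:
  assumes "prime p"
  shows "\<exists>r>0. r \<le> p + 1 \<and> p dvd U r"
proof (rule ccontr)
  assume neg: "\<not> ?thesis"
  have "\<exists>c<p. [c * U i = U (Suc i)] (mod p)" if "i \<in> {1..p + 1}" for i
  proof -
    have "coprime (U i) p" using neg that assms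
      by (metis atLeastAtMost_iff coprime_commute prime_imp_coprime_nat less_le_trans zero_less_one)
    then obtain x where x: "[U i * x = 1] (mod p)" 
      by (metis cong_solve_coprime_nat One_nat_def)
    have "[(x * U (Suc i)) * U i = U (Suc i)] (mod p)"
      using cong_mult[OF x cong_refl[of "U (Suc i)"]] by (simp add: mult_ac)
    hence "[(x * U (Suc i)) mod p * U i = U (Suc i)] (mod p)" by (simp add: cong_def mod_mult_left_eq)
    thus ?thesis using assms prime_gt_0_nat mod_less_divisor by blast
  qed
  then obtain f where f: "\<And>i. i \<in> {1..p + 1} \<Longrightarrow> f i < p \<and> [f i * U i = U (Suc i)] (mod p)" by metis
  have "card {..<p} < card {1..p + 1}" by simp
  moreover have "f ` {1..p + 1} \<subseteq> {..<p}" using f by auto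
  ultimately have "\<not> inj_on f {1..p + 1}" by (metis card_inj_on_le finite_lessThan not_less)
  then obtain i j where ij: "i \<in> {1..p + 1}" "j \<in> {1..p + 1}" "i < j" "f i = f j"
    unfolding inj_on_def by (metis linorder_neqE_nat)
  define t where "t = j - i"
  have j: "j = i + t" using ij by (simp add: t_def)
  have "[U (Suc i) * U j = f i * U i * U j] (mod p)"
    using f[OF ij(1)] cong_mult cong_refl cong_sym by blast
  also have "[f i * U i * U j = f j * U j * U i] (mod p)" by (simp add: ij(4) mult_ac)
  also have "[f j * U j * U i = U (Suc j) * U i] (mod p)"
    using f[OF ij(2)] cong_mult cong_refl by blast
  finally have "[int (U (Suc i)) * int (U j) = int (U (Suc j)) * int (U i)] (mod int p)"
    by (metis cong_int_iff of_nat_mult)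
  hence "int p dvd (-1) ^ i * int (U t)"
    using U_cross[of i t] unfolding j by (simp add: cong_iff_dvd_diff)
  hence "p dvd U t" by (cases "even i") auto
  moreover have "0 < t" "t \<le> p + 1" using ij by (auto simp: t_def)
  ultimately show False using neg by blast
qed

lemma apparition_pos: "prime p \<Longrightarrow> apparition p > 0"
  and dvd_U_apparition: "prime p \<Longrightarrow> p dvd U (apparition p)"
  and apparition_le_Suc: "prime p \<Longrightarrow> apparition p \<le> p + 1"
  and apparition_least: "0 < k \<Longrightarrow> p dvd U k \<Longrightarrow> apparition p \<le> k"
proof -
  assume "prime p"
  then obtain r where r: "r > 0" "r \<le> p + 1" "p dvd U r" using apparition_le by blast
  hence "apparition p > 0 \<and> p dvd U (apparition p)"
    unfolding apparition_def by (intro LeastI) auto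
  thus "apparition p > 0" "p dvd U (apparition p)" by auto
  show "apparition p \<le> p + 1"
    unfolding apparition_def using r by (intro order.trans[OF Least_le]) auto
next
  assume "0 < k" "p dvd U k"
  thus "apparition p \<le> k" unfolding apparition_def by (intro Least_le) auto
qed

text \<open>Descent by the rank \<open>r\<close>: modulo \<open>p\<close>, \<open>U_add\<close>
  gives \<open>U n = U (n - r) * U (r - 1)\<close>, and \<open>U (r - 1)\<close> is
  invertible.\<close>

lemma prime_dvd_U_iff:
  assumes "prime p"
  shows "p dvd U n \<longleftrightarrow> apparition p dvd n"
proof (induction n rule: less_induct)
  case (less n)
  define r where "r = apparition p"
  note r = apparition_pos[OF assms, folded r_def] dvd_U_apparition[OF assms, folded r_def]
  show ?case
  proof (cases "n < r")
    case True
    thus ?thesis using apparition_least[of n p] by (cases "n = 0") (auto simp: r_def dest: dvd_imp_le)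
  next
    case False
    obtain j where j: "r = Suc j" using r(1) gr0_implies_Suc by blast
    have Uj: "p dvd U (Suc j)" using r(2) j by simp
    have nj: "\<not> p dvd U j" by (rule prime_not_dvd_U_pred[OF assms Uj])
    define i where "i = n - r"
    have n: "n = i + Suc j" using False j by (simp add: i_def)
    have "p dvd U n \<longleftrightarrow> p dvd U i * U j"
      unfolding n U_add using Uj by (simp add: dvd_add_right_iff)
    also have "\<dots> \<longleftrightarrow> p dvd U i"
      using nj by (simp add: prime_dvd_mult_iff[OF assms])
    also have "\<dots> \<longleftrightarrow> r dvd i" unfolding r_def using less[of i] n by simp
    also have "\<dots> \<longleftrightarrow> r dvd n" by (simp add: n flip: j)
    finally show ?thesis by (simp add: r_def)
  qed
qed

lemma apparition_neq_1: "prime p \<Longrightarrow> apparition p \<noteq> 1"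
  using dvd_U_apparition[of p] by auto

text \<open>For odd \<open>n\<close>, \<open>U n\<close> is a polynomial in \<open>D = a\<^sup>2 + 4\<close>; these are its two lowest terms.\<close>
lemma U_odd_index:
  fixes j :: nat
  defines "D \<equiv> int a ^ 2 + 4"
  shows "\<exists>t. int (U (2 * j + 1)) = (-1) ^ j * ((2 * int j + 1) - (\<Sum>i\<le>j. int i ^ 2) * D) + D ^ 2 * t"
proof -
  define c where "c = (\<lambda>j. (2 * int j + 1) - (\<Sum>i\<le>j. int i ^ 2) * D)"
  have rec: "int (U (n + 4)) = (D - 2) * int (U (n + 2)) - int (U n)" for n
    by (simp add: D_def numeral_eq_Suc algebra_simps)
  have "(\<exists>t. int (U (2 * j + 1)) = (-1) ^ j * c j + D ^ 2 * t) \<and>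
    (\<exists>t. int (U (2 * Suc j + 1)) = (-1) ^ Suc j * c (Suc j) + D ^ 2 * t)" for j
  proof (induction j)
    case 0
    show ?case by (auto simp: c_def D_def numeral_eq_Suc intro!: exI[of _ 0])
  next
    case (Suc j)
    then obtain t t' where t: "int (U (2 * j + 1)) = (-1) ^ j * c j + D ^ 2 * t"
      "int (U (2 * Suc j + 1)) = (-1) ^ Suc j * c (Suc j) + D ^ 2 * t'" by blast
    define S where "S = (\<Sum>i\<le>j. int i ^ 2)"
    have c: "c j = 2 * int j + 1 - S * D" "c (Suc j) = 2 * int j + 3 - (S + (int j + 1) ^ 2) * D"
      "c (Suc (Suc j)) = 2 * int j + 5 - (S + (int j + 1) ^ 2 + (int j + 2) ^ 2) * D"
      by (simp_all add: c_def S_def add_ac)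
    have "int (U (2 * Suc (Suc j) + 1)) = (D - 2) * int (U (2 * Suc j + 1)) - int (U (2 * j + 1))"
      using rec[of "2 * j + 1"] by (simp add: numeral_eq_Suc)
    also have "\<dots> = (-1) ^ j * (- (D - 2) * c (Suc j) - c j) + D ^ 2 * ((D - 2) * t' - t)"
      unfolding t by (simp add: algebra_simps)
    also have "- (D - 2) * c (Suc j) - c j = c (Suc (Suc j)) + D ^ 2 * (S + (int j + 1) ^ 2)"
      unfolding c by (simp add: algebra_simps power2_eq_square)
    also have "(-1) ^ j * (c (Suc (Suc j)) + D ^ 2 * (S + (int j + 1) ^ 2)) + D ^ 2 * ((D - 2) * t' - t) =
      (-1) ^ Suc (Suc j) * c (Suc (Suc j)) + D ^ 2 * ((-1) ^ j * (S + (int j + 1) ^ 2) + ((D - 2) * t' - t))"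
      by (simp add: algebra_simps)
    finally show ?case using t(2) by blast
  qed
  thus ?thesis unfolding c_def by blast
qed

section \<open>Ramified primes and prime indices\<close>

text \<open>With \<open>p = 2 * j + 1\<close>, every term of the expansion of \<open>U p\<close> in
  \<open>U_odd_index\<close> is divisible by \<open>p\<close>, so the rank is a divisor of
  \<open>p\<close> other than 1.\<close>

lemma apparition_ramified:
  assumes "prime p" "odd p" "p dvd a\<^sup>2 + 4"
  shows "apparition p = p"
proof -
  obtain j where j: "p = 2 * j + 1" using assms(2) oddE by blast
  have "2 * int j + 1 = int p" by (simp add: j)
  then obtain t where t: "int (U p) = (-1) ^ j * (int p - (\<Sum>i\<le>j. int i ^ 2) * (int a ^ 2 + 4)) + (int a ^ 2 + 4) ^ 2 * t"
    using U_odd_index[of j] unfolding j[symmetric] by metis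
  have "int p dvd int a ^ 2 + 4" using assms(3) by (metis of_nat_add of_nat_dvd_iff of_nat_numeral of_nat_power)
  then obtain e where e: "int a ^ 2 + 4 = int p * e" by blast
  have "int (U p) = int p * ((-1) ^ j * (1 - (\<Sum>i\<le>j. int i ^ 2) * e) + e * (int p * e) * t)"
    unfolding t e by (simp add: algebra_simps power2_eq_square)
  hence "p dvd U p" by (metis dvd_triv_left of_nat_dvd_iff)
  hence "apparition p dvd p" using assms(1) prime_dvd_U_iff by simp
  thus ?thesis using assms(1) apparition_neq_1 by (metis prime_nat_iff)
qed

text \<open>Since \<open>6 * S = j * (j + 1) * p\<close> and \<open>p\<close> is prime to 6, the
  coefficient \<open>S\<close> is divisible by \<open>p\<close>. Hence \<open>U p\<close> is
  \<open>p\<close> or \<open>- p\<close> modulo \<open>p ^ 2\<close>.\<close>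

lemma not_square_dvd_U_ramified:
  assumes "prime p" "p \<ge> 5" "p dvd a\<^sup>2 + 4"
  shows "\<not> p ^ 2 dvd U p"
proof
  assume dvd: "p ^ 2 dvd U p"
  have "odd p" using assms prime_odd_nat by auto
  then obtain j where j: "p = 2 * j + 1" using oddE by blast
  define S where "S = (\<Sum>i\<le>j. int i ^ 2)"
  have "2 * int j + 1 = int p" by (simp add: j)
  then obtain t where t: "int (U p) = (-1) ^ j * (int p - S * (int a ^ 2 + 4)) + (int a ^ 2 + 4) ^ 2 * t"
    using U_odd_index[of j] unfolding j[symmetric] S_def by metis
  have D: "int p dvd int a ^ 2 + 4" using assms(3) by (metis of_nat_add of_nat_dvd_iff of_nat_numeral of_nat_power)
  have "6 * (\<Sum>i\<le>n. int i ^ 2) = int n * (int n + 1) * (2 * int n + 1)" for n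
    by (induction n) (simp_all add: algebra_simps power2_eq_square)
  hence "6 * S = int j * (int j + 1) * int p" by (simp add: S_def j)
  hence "int p dvd 6 * S" by simp
  moreover have "\<not> int p dvd 6"
  proof
    assume "int p dvd 6"
    hence "p dvd 6" by (metis of_nat_dvd_iff of_nat_numeral)
    hence "p \<le> 6" by (auto dest: dvd_imp_le)
    moreover have "p \<noteq> 6" using \<open>odd p\<close> by auto
    ultimately have "p = 5" using assms(2) by linarith
    thus False using \<open>p dvd 6\<close> by simp
  qed
  ultimately have "int p dvd S" using assms(1) by (simp add: prime_dvd_mult_iff)
  hence "int p ^ 2 dvd S * (int a ^ 2 + 4)" using D by (simp add: power2_eq_square mult_dvd_mono)
  moreover have "int p ^ 2 dvd (int a ^ 2 + 4) ^ 2" using D by (rule dvd_power_same)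
  moreover have "int p ^ 2 dvd int (U p)" using dvd by (metis of_nat_dvd_iff of_nat_power)
  ultimately have "int p ^ 2 dvd int (U p) - (int a ^ 2 + 4) ^ 2 * t + (-1) ^ j * (S * (int a ^ 2 + 4))"
    by (intro dvd_add dvd_diff) auto
  also have "\<dots> = (-1) ^ j * int p" unfolding t by (simp add: algebra_simps)
  finally have "int p ^ 2 dvd int p" by (cases "even j") auto
  hence "p ^ 2 dvd p" by (metis of_nat_dvd_iff of_nat_power)
  hence "p ^ 2 \<le> p" using assms(2) by (auto dest: dvd_imp_le)
  thus False using assms(2) by (simp add: power2_eq_square)
qed

text \<open>The bound starts at 6 because \<open>U 5 = 5\<close> for \<open>a = 1\<close>.\<close>

lemma U_gt_index: "n \<ge> 6 \<Longrightarrow> U n > n"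
proof -
  have "U (n + 6) > n + 6 \<and> U (n + 7) > n + 7" for n
  proof (induction n)
    case 0
    have pos: "a ^ k > 0" for k using a_pos by simp
    have "a ^ 5 + 4 * a ^ 3 + 3 * a > 6" "a ^ 6 + 5 * a ^ 4 + 6 * a ^ 2 + 1 > 7"
      using a_pos pos[of 2] pos[of 3] pos[of 4] pos[of 5] pos[of 6] by linarith+
    moreover have "U 6 = a ^ 5 + 4 * a ^ 3 + 3 * a" "U 7 = a ^ 6 + 5 * a ^ 4 + 6 * a ^ 2 + 1"
      by (simp_all add: numeral_eq_Suc algebra_simps)
    ultimately show ?case by simp
  next
    case (Suc n)
    have "U (n + 8) = a * U (n + 7) + U (n + 6)" by (simp add: numeral_eq_Suc)
    moreover have "a * U (n + 7) \<ge> U (n + 7)" using a_pos by simp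
    ultimately have "U (n + 8) > n + 8" using Suc by linarith
    moreover have "Suc n + 6 = n + 7" "Suc n + 7 = n + 8" by auto
    ultimately show ?case using Suc by (simp only:)
  qed
  thus "n \<ge> 6 \<Longrightarrow> U n > n" by (metis add.commute le_add_diff_inverse)
qed

text \<open>All prime factors of \<open>U m\<close> have rank \<open>m\<close>. If they were all
  ramified, they would equal \<open>m\<close> by \<open>apparition_ramified\<close>; as
  \<open>m ^ 2\<close> does not divide \<open>U m\<close>, this forces \<open>U m \<le> m\<close>,
  against the growth of \<open>U\<close>.\<close>

lemma primitive_prime_index:
  assumes "prime m" "m \<ge> 5" "a \<noteq> 1 \<or> m \<noteq> 5"
  shows "\<exists>p. prime p \<and> apparition p = m \<and> \<not> p dvd a\<^sup>2 + 4"
proof (rule ccontr)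
  assume neg: "\<not> ?thesis"
  have "p = m" if p: "prime p" "p dvd U m" for p
  proof -
    have "apparition p = m"
      using p assms(1) prime_dvd_U_iff apparition_neq_1 by (metis prime_nat_iff)
    moreover from this have "p dvd a\<^sup>2 + 4" using neg p by blast
    moreover have "odd p"
      using \<open>apparition p = m\<close> apparition_le_Suc[OF p(1)] assms(2) p(1) prime_odd_nat prime_ge_2_nat[OF p(1)]
      by (cases "p = 2") auto
    ultimately show ?thesis using apparition_ramified p(1) by simp
  qed
  hence sub: "prime_factors (U m) \<subseteq> {m}" by (auto simp: prime_factors_dvd)
  have Upos: "U m \<noteq> 0" using assms(2) by simp
  have "U m > m"
  proof (cases "m = 5")
    case True
    hence "a > 1" using assms(3) a_pos by simp
    hence "a ^ 4 \<ge> 2 ^ 4" by (intro power_mono) auto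
    moreover have "U 5 = a ^ 4 + 3 * a ^ 2 + 1"
      by (simp add: numeral_eq_Suc algebra_simps)
    ultimately show ?thesis by (simp add: True)
  next
    case False
    thus ?thesis using assms(2) by (intro U_gt_index) auto
  qed
  have "U m = (\<Prod>p\<in>prime_factors (U m). p ^ multiplicity p (U m))"
    using prod_prime_factors[OF Upos] by simp
  also have "\<dots> \<le> m ^ 1"
  proof (cases "prime_factors (U m) = {}")
    case False
    hence eq: "prime_factors (U m) = {m}" using sub by blast
    hence "m dvd U m" by blast
    hence "m dvd a\<^sup>2 + 4" using neg assms(1) prime_dvd_U_iff apparition_neq_1 by (metis prime_nat_iff)
    hence "\<not> m ^ 2 dvd U m" using not_square_dvd_U_ramified assms by blast
    hence "multiplicity m (U m) < 2" using multiplicity_dvd' not_less by blast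
    thus ?thesis using assms(2) unfolding eq by (simp add: power_increasing[of _ 1, simplified])
  qed (use assms(2) in auto)
  finally show False using \<open>U m > m\<close> by simp
qed

section \<open>Primes with a prescribed rank of apparition\<close>

text \<open>The Moebius sum treats the three summands separately: the linear one gives the totient,
  the constant one vanishes, and the middle one, with
  \<open>\<beta> / \<alpha> = - 1 / \<alpha>\<^sup>2\<close>, is a small error.\<close>

lemma ln_U:
  assumes "n > 0"
  shows "ln (real (U n)) = real n * ln \<alpha> + ln (1 - (- 1 / \<alpha>\<^sup>2) ^ n) + - ln (\<alpha> - \<beta>)"
proof -
  note pos = \<alpha>_pos
  have "\<beta> = \<alpha> * (- 1 / \<alpha>\<^sup>2)" using \<alpha>_times_\<beta> pos by (simp add: field_simps power2_eq_square)
  hence "\<beta> ^ n = \<alpha> ^ n * (- 1 / \<alpha>\<^sup>2) ^ n" by (metis power_mult_distrib)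
  hence "(\<alpha> - \<beta>) * real (U n) = \<alpha> ^ n * (1 - (- 1 / \<alpha>\<^sup>2) ^ n)"
    unfolding U_Binet by (simp add: algebra_simps)
  hence eq: "real (U n) = \<alpha> ^ n * (1 - (- 1 / \<alpha>\<^sup>2) ^ n) / (\<alpha> - \<beta>)"
    using \<alpha>_gt_\<beta> by (simp add: field_simps)
  have "0 < real (U n)" using U_pos assms by simp
  hence "1 - (- 1 / \<alpha>\<^sup>2) ^ n > 0"
    unfolding eq using pos \<alpha>_gt_\<beta> by (simp add: zero_less_divide_iff zero_less_mult_iff)
  thus ?thesis unfolding eq using pos \<alpha>_gt_\<beta> by (simp add: ln_mult ln_div ln_realpow)
qed

lemma mobius_sum_ln_U_ge:
  assumes "m > 1"
  shows "mobius_sum (\<lambda>n. ln (real (U n))) m \<ge> real (totient m) * ln \<alpha> - 2 / 3"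
proof -
  define x where "x = 1 / \<alpha>\<^sup>2"
  note pos = \<alpha>_pos
  have "\<alpha>\<^sup>2 \<ge> (809 / 500)\<^sup>2" using \<alpha>_ge by (intro power_mono) auto
  hence "\<alpha>\<^sup>2 \<ge> 26179 / 10000" by (simp add: power2_eq_square)
  hence x: "0 < x" "x \<le> 191 / 500" using pos by (simp_all add: x_def divide_simps)
  have x2: "x\<^sup>2 \<le> (73 / 500)"
  proof -
    have "x\<^sup>2 \<le> (191 / 500)\<^sup>2" using x by (intro power_mono) auto
    thus ?thesis by (simp add: power2_eq_square)
  qed
  have x2pos: "x\<^sup>2 > 0" using x by simp
  \<comment> \<open>A majorant of the error, from \<open>ln (1 + y) \<le> y\<close> for odd
    \<open>n\<close> and \<open>- ln (1 - y) \<le> y / (1 - y)\<close> for even \<open>n\<close>;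
    putting \<open>x\<^sup>2\<close> for \<open>y\<close> in the denominator makes the sums
    geometric.\<close>
  define h where "h = (\<lambda>n. if even n then x ^ n / (1 - x\<^sup>2) else x ^ n)"
  define f where "f = (\<lambda>n. ln (1 - (- x) ^ n))"
  have fh: "\<bar>f n\<bar> \<le> h n" if n: "n > 0" for n
  proof (cases "even n")
    case False
    have "0 \<le> ln (1 + x ^ n)" "ln (1 + x ^ n) \<le> x ^ n"
      using x by (auto intro: ln_add_one_self_le_self)
    thus ?thesis using False by (simp add: f_def h_def)
  next
    case True
    define y where "y = x ^ n"
    have "n \<ge> 2" using n True by (auto elim!: evenE)
    hence "y \<le> x\<^sup>2" unfolding y_def using x by (intro power_decreasing) auto
    hence "y < 1" using x2 by linarith
    hence y: "0 < y" "y \<le> x\<^sup>2" "y < 1" using x \<open>y \<le> x\<^sup>2\<close> by (simp_all add: y_def)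
    have "- ln (1 - y) = ln (1 / (1 - y))" using y by (simp add: ln_div)
    also have "\<dots> \<le> 1 / (1 - y) - 1" using y by (intro ln_le_minus_one) auto
    also have "\<dots> = y / (1 - y)" using y by (simp add: field_simps)
    also have "\<dots> \<le> y / (1 - x\<^sup>2)" using y x2 by (intro divide_left_mono mult_pos_pos) auto
    finally have "- ln (1 - y) \<le> y / (1 - x\<^sup>2)" .
    moreover have "ln (1 - y) \<le> 0" using y by simp
    ultimately show ?thesis using True by (simp add: f_def h_def y_def)
  qed
  \<comment> \<open>\<open>h (2 * k + 1) + h (2 * k + 2)\<close> is \<open>x ^ (2 * k) * K\<close>.
    Summing in such pairs is the reason for the even upper limit \<open>2 * m\<close> below.\<close>
  define K where "K = x + x\<^sup>2 / (1 - x\<^sup>2)"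
  have "(\<Sum>n\<in>{1..2 * k}. h n) = K * (1 - (x\<^sup>2) ^ k) / (1 - x\<^sup>2)" for k
  proof (induction k)
    case (Suc k)
    have "{1..2 * Suc k} = insert (2 * k + 2) (insert (2 * k + 1) {1..2 * k})" by auto
    hence "(\<Sum>n\<in>{1..2 * Suc k}. h n) = h (2 * k + 2) + (h (2 * k + 1) + (\<Sum>n\<in>{1..2 * k}. h n))" by simp
    also have "h (2 * k + 2) + (h (2 * k + 1) + (\<Sum>n\<in>{1..2 * k}. h n)) =
      (x\<^sup>2) ^ k * K + (\<Sum>n\<in>{1..2 * k}. h n)"
      by (simp add: h_def K_def algebra_simps power_add power_mult power2_eq_square power_mult_distrib)
    also have "\<dots> = K * (1 - (x\<^sup>2) ^ Suc k) / (1 - x\<^sup>2)"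
      unfolding Suc using x2 by (simp add: field_simps)
    finally show ?case .
  qed simp
  note hsum = this
  have "\<bar>mobius_sum f m\<bar> \<le> (\<Sum>n\<in>{1..m}. h n)"
    using assms fh by (intro mobius_sum_abs_le) auto
  also have "\<dots> \<le> (\<Sum>n\<in>{1..2 * m}. h n)"
    using x x2 by (intro sum_mono2) (auto simp: h_def)
  also have "\<dots> \<le> K / (1 - x\<^sup>2)"
    unfolding hsum K_def using x x2 by (intro divide_right_mono mult_left_le) (auto simp: power_le_one)
  also have "\<dots> \<le> 2 / 3"
  proof -
    have "x\<^sup>2 / (1 - x\<^sup>2) \<le> (73 / 500) / (1 - (73 / 500))" using x2 x2pos by (intro frac_le) auto
    hence "K \<le> (5531 / 10000)" unfolding K_def using x by simp
    hence "K / (1 - x\<^sup>2) \<le> (5531 / 10000) / (1 - (73 / 500))" using x2 x2pos by (intro frac_le) auto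
    thus ?thesis by simp
  qed
  finally have f: "\<bar>mobius_sum f m\<bar> \<le> 2 / 3" .
  have "mobius_sum (\<lambda>n. ln (real (U n))) m = mobius_sum (\<lambda>n. real n * ln \<alpha> + f n + - ln (\<alpha> - \<beta>)) m"
    using assms ln_U by (intro mobius_sum_cong) (auto simp: f_def x_def)
  also have "\<dots> = real (totient m) * ln \<alpha> + mobius_sum f m"
    using assms by (simp only: mobius_sum_add mobius_sum_cmult mobius_sum_const mobius_sum_real)
  finally show ?thesis using f by linarith
qed

text \<open>The exceptions \<open>4\<close> and \<open>6\<close> are the cases \<open>m = 2 * apparition 2\<close>, where \<open>U m / U (m div 2)\<close>
  may be divisible by \<open>4\<close>.\<close>
lemma mobius_sum_multiplicity_U:
  assumes p: "prime p" "apparition p \<noteq> m" and m: "m > 0" "m \<notin> {4, 6}"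
  shows "mobius_sum (\<lambda>n. real (multiplicity p (U n))) m =
    (if \<exists>k. m = apparition p * p ^ k then 1 else 0)"
proof -
  define r where "r = apparition p"
  define g where "g = (\<lambda>n. real (multiplicity p (U n)))"
  note r0 = apparition_pos[OF p(1), folded r_def]
  have g0: "g n = 0" if "\<not> r dvd n" for n
    using that prime_dvd_U_iff[OF p(1), of n] by (simp add: g_def r_def not_dvd_imp_multiplicity_0)
  \<comment> \<open>Off the multiples of the rank everything is 0. A prime
    \<open>q \<noteq> p\<close> in \<open>m div r\<close> makes the sum cancel, as a factor
    \<open>q\<close> does not change the multiplicity of \<open>p\<close>. What remains is
    \<open>m = r * p ^ k\<close>, where one factor \<open>p\<close> survives.\<close>
  consider (notdvd) "\<not> r dvd m" | (other) q where "r dvd m" "prime q" "q \<noteq> p" "q dvd m div r"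
    | (power) k where "m = r * p ^ k"
  proof (cases "r dvd m")
    case True
    define t where "t = m div r"
    have mt: "m = r * t" using True by (simp add: t_def)
    hence t0: "t \<noteq> 0" using m(1) by auto
    show ?thesis
    proof (cases "\<exists>q. prime q \<and> q \<noteq> p \<and> q dvd t")
      case False
      hence "prime_factors t \<subseteq> {p}" by (auto simp: prime_factors_dvd)
      hence "(\<Prod>q\<in>prime_factors t. q ^ multiplicity q t) = (\<Prod>q\<in>{p}. q ^ multiplicity q t)"
        using p(1) by (intro prod.mono_neutral_left) (auto simp: prime_factors_multiplicity)
      hence "t = p ^ multiplicity p t" using prod_prime_factors[OF t0] by simp
      thus ?thesis using that(3) mt by metis
    qed (use that(2) True t_def in blast)
  qed (use that in blast)
  thus ?thesis
  proof cases
    case notdvd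
    hence "mobius_sum g m = mobius_sum (\<lambda>_. 0) m"
      using m(1) by (intro mobius_sum_cong g0) (auto dest: dvd_trans)
    moreover have "\<nexists>k. m = r * p ^ k" using notdvd by auto
    ultimately show ?thesis by (simp add: g_def r_def mobius_sum_def)
  next
    case (other q)
    define t where "t = m div r"
    have mt: "m = r * t" "q dvd t" using other by (simp_all add: t_def)
    have "mobius_sum g m = 0"
    proof (rule mobius_sum_eq_0[OF m(1)])
      show "q \<in> prime_factors m" using other mt m(1) by (auto simp: prime_factors_dvd)
      fix n assume n: "n dvd m" "\<not> q dvd m div n"
      have n0: "n > 0" using n(1) m(1) by (auto intro: Nat.gr0I)
      define s where "s = m div n"
      have ms: "m = n * s" "\<not> q dvd s" using n by (simp_all add: s_def)
      have "q dvd n" using ms mt other(2) by (metis dvd_mult prime_dvd_mult_iff)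
      then obtain n' where n': "n = q * n'" by blast
      have q0: "q > 0" using other(2) prime_gt_0_nat by blast
      show "g n = g (n div q)"
      proof (cases "r dvd n")
        case True
        then obtain y where y: "n = r * y" by blast
        have "r * t = r * (y * s)" using mt(1) ms(1) y by (metis mult.assoc)
        hence "t = y * s" using r0 by (metis mult_cancel1 not_gr_zero)
        hence "q dvd y" using mt(2) ms(2) other(2) by (metis prime_dvd_mult_iff)
        hence "r dvd n'" using y n' q0 by (auto elim!: dvdE simp: mult_ac)
        hence "p dvd U n'" using p(1) prime_dvd_U_iff r_def by simp
        moreover have "\<not> p dvd q" using other p(1) primes_dvd_imp_eq by blast
        ultimately show ?thesis
          using multiplicity_U_times_other[OF p(1), of n' q] n0 q0 by (simp add: g_def n')
      next
        case False
        moreover from this have "\<not> r dvd n'" using n' by auto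
        ultimately show ?thesis using g0 n' q0 by simp
      qed
    qed
    moreover have "\<nexists>k. m = r * p ^ k"
    proof
      assume "\<exists>k. m = r * p ^ k"
      then obtain k where "r * t = r * p ^ k" using mt by metis
      hence "q dvd p ^ k" using mt(2) r0 by simp
      thus False using other(2,3) p(1) by (meson prime_dvd_power primes_dvd_imp_eq)
    qed
    ultimately show ?thesis by (simp add: g_def r_def)
  next
    case (power k)
    have p0: "p > 0" using p(1) prime_gt_0_nat by blast
    have "k \<noteq> 0" using power p(2) unfolding r_def by (metis mult.right_neutral power_0)
    then obtain i where i: "k = Suc i" using not0_implies_Suc by blast
    define m' where "m' = r * p ^ i"
    have mm: "m = p * m'" by (simp add: power i m'_def)
    have "mobius_sum g m = g m - g (m div p)"
    proof (rule mobius_sum_eq_single[OF m(1)])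
      show "p \<in> prime_factors m" using p(1) m(1) mm by (auto simp: prime_factors_dvd)
      fix n assume n: "n dvd m" "n \<noteq> m" "\<not> p dvd m div n"
      define s where "s = m div n"
      have ms: "m = n * s" "\<not> p dvd s" using n by (simp_all add: s_def)
      \<comment> \<open>If \<open>r\<close> divided \<open>n\<close>, the cofactor \<open>s\<close>
        would divide \<open>p ^ k\<close> and hence be 1.\<close>
      have "\<not> r dvd n"
      proof
        assume "r dvd n"
        then obtain y where y: "n = r * y" by blast
        have "r * p ^ k = r * (y * s)" using power ms(1) y by (metis mult.assoc)
        hence "s dvd p ^ k" using r0 by simp
        moreover have "coprime s (p ^ k)"
          using ms(2) p(1) by (metis coprime_commute coprime_power_right_iff prime_imp_coprime)
        ultimately have "s = 1" by (metis coprime_common_divisor_nat dvd_refl)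
        thus False using ms n(2) by simp
      qed
      moreover from this have "\<not> r dvd n div p"
      proof (cases "p dvd n")
        case False
        moreover have "p dvd n * s" using mm ms(1) by simp
        ultimately show ?thesis using ms(2) p(1) by (auto simp: prime_dvd_mult_iff)
      qed (metis dvd_div_mult_self dvd_mult2)
      ultimately show "g n = g (n div p)" using g0 by simp
    qed
    also have "multiplicity p (U m) = Suc (multiplicity p (U m'))"
    proof (cases "odd p")
      case True
      have "p dvd U m'" using p(1) prime_dvd_U_iff by (simp add: m'_def r_def)
      thus ?thesis unfolding mm using multiplicity_U_times_odd_prime True p(1) r0 p0 by (simp add: m'_def)
    next
      case False
      hence p2: "p = 2" using p(1) prime_odd_nat prime_ge_2_nat[OF p(1)] by (cases "p = 2") auto
      have "r \<le> 3" "r \<noteq> 1"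
        using apparition_le_Suc[OF p(1)] apparition_neq_1[OF p(1)] by (simp_all add: r_def p2)
      hence "r = 2 \<or> r = 3" using r0 by linarith
      \<comment> \<open>For \<open>i = 0\<close> one would have \<open>m = 2 * r\<close>, that is 4
        or 6; beyond this first doubling \<open>multiplicity_2_U\<close> applies.\<close>
      hence "i \<noteq> 0" using m(2) power i p2 by auto
      then obtain l where l: "i = Suc l" using not0_implies_Suc by blast
      have "even (U (r * 2 ^ l))" using prime_dvd_U_iff[OF p(1)] by (simp add: r_def p2)
      moreover have "m = 2 * (2 * (r * 2 ^ l))" "m' = 2 * (r * 2 ^ l)"
        by (simp_all add: power i l p2 m'_def)
      ultimately show ?thesis using multiplicity_2_U[of "r * 2 ^ l"] r0 by (simp add: p2)
    qed
    hence "g m - g (m div p) = 1" using p0 by (simp add: g_def mm)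
    finally show ?thesis using power by (auto simp: g_def r_def)
  qed
qed

text \<open>If no prime has rank of apparition \<open>m\<close>, these are the primes dividing the primitive part of \<open>U m\<close>.\<close>
definition returning :: "nat \<Rightarrow> nat set" where
  "returning m = {p. prime p \<and> (\<exists>k. m = apparition p * p ^ k)}"

text \<open>Exponentiates the comparison of the two evaluations of the Moebius sum of
  \<open>ln (U n)\<close>; the factor 2 bounds \<open>exp (2 / 3)\<close>.\<close>

lemma \<alpha>_power_totient_le:
  assumes m: "m > 2" "m \<notin> {4, 6}" and no: "\<nexists>p. prime p \<and> apparition p = m"
  shows "finite (returning m)" "\<alpha> ^ totient m \<le> 2 * real (\<Prod>(returning m))"
proof -
  have m0: "m > 0" using m by simp
  define A where "A = prime_factors (U m)"
  have Um: "U m \<noteq> 0" using m0 by simp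
  have sub: "returning m \<subseteq> A"
    using Um by (auto simp: returning_def A_def prime_factors_dvd prime_dvd_U_iff)
  thus fin: "finite (returning m)" by (rule finite_subset) (simp add: A_def)
  have prime_A: "prime p" if "p \<in> A" for p using that unfolding A_def by blast
  have "mobius_sum (\<lambda>n. ln (real (U n))) m =
    mobius_sum (\<lambda>n. \<Sum>p\<in>A. real (multiplicity p (U n)) * ln (real p)) m"
  proof (intro mobius_sum_cong ln_prime_decomposition)
    fix n assume "n dvd m"
    thus "prime_factors (U n) \<subseteq> A"
      unfolding A_def using U_dvd Um by (intro dvd_prime_factors) auto
  qed (use m0 prime_A in \<open>auto simp: A_def U_pos\<close>)
  also have "\<dots> = (\<Sum>p\<in>A. mobius_sum (\<lambda>n. real (multiplicity p (U n))) m * ln (real p))"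
    unfolding mobius_sum_sum mobius_sum_cmult ..
  also have "\<dots> = (\<Sum>p\<in>A. (if p \<in> returning m then 1 else 0) * ln (real p))"
  proof (rule sum.cong[OF refl])
    fix p assume "p \<in> A"
    thus "mobius_sum (\<lambda>n. real (multiplicity p (U n))) m * ln (real p) =
        (if p \<in> returning m then 1 else 0) * ln (real p)"
      using mobius_sum_multiplicity_U[of p m] prime_A no m m0 by (auto simp: returning_def)
  qed
  also have "\<dots> = (\<Sum>p\<in>returning m. ln (real p))"
    using sub by (intro sum.mono_neutral_cong_right) (auto simp: A_def)
  also have "\<dots> = ln (\<Prod>p\<in>returning m. real p)"
    by (rule ln_prod[symmetric, OF fin]) (auto simp: returning_def dest: prime_gt_0_nat)
  finally have "real (totient m) * ln \<alpha> - 2 / 3 \<le> ln (\<Prod>p\<in>returning m. real p)"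
    using mobius_sum_ln_U_ge[of m] m by simp
  hence "ln (\<alpha> ^ totient m) \<le> ln (\<Prod>p\<in>returning m. real p) + 2 / 3"
    by (simp add: ln_realpow)
  moreover have pos: "(\<Prod>p\<in>returning m. real p) > 0"
    by (intro prod_pos) (auto simp: returning_def prime_gt_0_nat)
  ultimately have "\<alpha> ^ totient m \<le> exp (ln (\<Prod>p\<in>returning m. real p) + 2 / 3)"
    using \<alpha>_pos by (metis exp_le_cancel_iff exp_ln zero_less_power)
  also have "\<dots> = (\<Prod>p\<in>returning m. real p) * exp (2 / 3)"
    using pos by (simp add: exp_add)
  also have "exp (2 / 3 :: real) \<le> 2"
  proof -
    \<comment> \<open>Sixteen such factors suffice, because \<open>(23 / 24) ^ 16\<close> exceeds
      \<open>1 / 2\<close>.\<close>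
    have "1 - 1 / 24 \<le> exp (- 1 / 24 :: real)" using exp_ge_add_one_self[of "- 1 / 24 :: real"] by simp
    hence "(1 - 1 / 24) ^ 16 \<le> exp (- 1 / 24 :: real) ^ 16" by (intro power_mono) auto
    also have "\<dots> = exp (- (2 / 3))" by (simp flip: exp_of_nat_mult)
    finally have "1 / 2 \<le> exp (- (2 / 3 :: real))" by (simp add: power_divide field_simps)
    thus ?thesis by (simp add: exp_minus field_simps)
  qed
  finally show "\<alpha> ^ totient m \<le> 2 * real (\<Prod>(returning m))" using pos by simp
qed

section \<open>Carmichael's theorem outside small indices\<close>

lemma power_\<alpha>_mono:
  assumes "real c < (809 / 500) ^ k" "k \<le> n"
  shows "real c < \<alpha> ^ n"
proof -
  have "(809 / 500 :: real) ^ k \<le> (809 / 500) ^ n" using assms(2) by (intro power_increasing) auto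
  also have "\<dots> \<le> \<alpha> ^ n" using \<alpha>_ge by (intro power_mono) auto
  finally show ?thesis using assms(1) by linarith
qed

text \<open>Otherwise the returning primes divide \<open>m\<close>, at most one of them is odd, and
  their product is too small for \<open>\<alpha>_power_totient_le\<close>. At 10 and 12 the totient
  is only 4, and the estimate does not beat the possible products 5 and 6.\<close>

theorem ex_apparition:
  assumes m: "m > 2" "m \<notin> {4, 6, 10, 12}"
  shows "\<exists>p. prime p \<and> apparition p = m"
proof (rule ccontr)
  assume no: "\<nexists>p. prime p \<and> apparition p = m"
  define T where "T = returning m"
  have T: "prime p \<and> (\<exists>k. m = apparition p * p ^ Suc k)" if p: "p \<in> T" for p
  proof -
    obtain k where k: "prime p" "m = apparition p * p ^ k" using p by (auto simp: T_def returning_def)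
    moreover have "k \<noteq> 0" using k no by (metis mult.right_neutral power_0)
    ultimately show ?thesis using not0_implies_Suc by metis
  qed
  have dvd: "p dvd m" if "p \<in> T" for p using T[OF that] by auto
  have m0: "m > 0" using m by simp
  have fin: "finite T" and le: "\<alpha> ^ totient m \<le> 2 * real (\<Prod>T)"
    using \<alpha>_power_totient_le m no by (auto simp: T_def)
  \<comment> \<open>Each case below supplies an upper bound \<open>b\<close> for the product and a
    lower bound \<open>k\<close> for the totient.\<close>
  have contr: False if "2 * real b < (809 / 500) ^ k" "\<Prod>T \<le> b" "k \<le> totient m" for b k
  proof -
    have "real (2 * b) < \<alpha> ^ totient m" using that by (intro power_\<alpha>_mono[of _ k]) auto
    moreover have "real (\<Prod>T) \<le> real b" using that(2) by (rule of_nat_mono)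
    ultimately show False using le by linarith
  qed
  have totient: "totient n \<le> totient m" if "n dvd m" for n
    using totient_dvd_mono[OF that m0] .
  have odd_unique: "p = q" if "p \<in> T" "q \<in> T" "odd p" "odd q" for p q
  proof -
    \<comment> \<open>For odd \<open>p < q\<close> in \<open>T\<close>, \<open>q\<close> divides the
      rank of \<open>p\<close>, which is at most \<open>p + 1\<close>; so \<open>q = p + 1\<close>,
      contrary to parity.\<close>
    have *: False if pq: "p \<in> T" "q \<in> T" "odd p" "odd q" "p < q" for p q
    proof -
      obtain k where k: "m = apparition p * p ^ Suc k" "prime p" using T pq(1) by blast
      have q: "prime q" "q dvd m" using T dvd pq(2) by auto
      have "\<not> q dvd p ^ Suc k" using q(1) k(2) pq(5) by (metis less_irrefl prime_dvd_power primes_dvd_imp_eq)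
      hence "q dvd apparition p" using q k(1) by (metis prime_dvd_mult_iff)
      hence "q \<le> apparition p" using apparition_pos[OF k(2)] by (rule dvd_imp_le)
      hence "q = p + 1" using apparition_le_Suc[OF k(2)] pq(5) by simp
      thus False using pq(3,4) by simp
    qed
    show ?thesis using *[of p q] *[of q p] that by (cases p q rule: linorder_cases) auto
  qed
  have app: "2 \<le> apparition p" "apparition p \<le> p + 1" if "prime p" for p
    using apparition_pos[OF that] apparition_neq_1[OF that] apparition_le_Suc[OF that] by auto
  show False
  proof (cases "2 \<in> T")
    case True
    then obtain k where k: "m = apparition 2 * 2 ^ Suc k" using T by blast
    have "apparition 2 = 2 \<or> apparition 2 = 3" using app[of 2] by auto
    thus False
    proof
      assume r: "apparition 2 = 2"
      have "k \<noteq> 0" using k m r by auto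
      then obtain l where l: "k = Suc l" using not0_implies_Suc by blast
      have m8: "m = 8 * 2 ^ l" and m2: "m = 2 ^ (l + 3)" using k r l by (simp_all add: power_add)
      have "p = 2" if "p \<in> T" for p
      proof -
        have "prime p" "p dvd 2 ^ (l + 3)" using T[OF that] dvd[OF that] m2 by simp_all
        thus ?thesis by (metis prime_dvd_power primes_dvd_imp_eq two_is_prime_nat)
      qed
      hence "T = {2}" using True by blast
      moreover have "totient 8 \<le> totient m" by (rule totient) (simp add: m8)
      ultimately show False by (intro contr[of 2 4]) (auto simp: power_divide)
    next
      assume r: "apparition 2 = 3"
      have "k \<noteq> 0" "k \<noteq> 1" using k m r by auto
      then obtain l where l: "k = Suc (Suc l)" by (metis One_nat_def not0_implies_Suc)
      have m24: "m = 24 * 2 ^ l" and m2: "m = 2 ^ (l + 3) * 3" using k r l by (simp_all add: power_add)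
      have "p = 2 \<or> p = 3" if "p \<in> T" for p
      proof -
        have "prime p" "p dvd 2 ^ (l + 3) * 3" using T[OF that] dvd[OF that] m2 by simp_all
        moreover have "prime (3 :: nat)" by simp
        ultimately show ?thesis
          by (metis prime_dvd_mult_iff prime_dvd_power primes_dvd_imp_eq two_is_prime_nat)
      qed
      hence "T \<subseteq> {2, 3}" by blast
      hence "\<Prod>T dvd \<Prod>{2, 3 :: nat}" by (intro prod_dvd_prod_subset) auto
      hence "\<Prod>T \<le> 6" by (auto dest: dvd_imp_le)
      moreover have "totient 24 \<le> totient m" by (rule totient) (simp add: m24)
      moreover have "totient (24 :: nat) = 8" by code_simp
      ultimately show False by (intro contr[of 6 8]) (auto simp: power_divide)
    qed
  next
    case False
    have odd: "odd p" if "p \<in> T" for p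
      using T[OF that] that False prime_odd_nat prime_ge_2_nat[of p] by (cases "p = 2") auto
    show False
    proof (cases "T = {}")
      case True
      have "totient m \<ge> 2" using totient_gt_1[OF m(1)] by simp
      thus False using True by (intro contr[of 1 2]) (auto simp: power_divide)
    next
      case nonempty: False
      then obtain p where p: "p \<in> T" by blast
      hence Tp: "T = {p}" using odd_unique odd by blast
      obtain k where k: "prime p" "m = apparition p * p ^ Suc k" using T p by blast
      note r = app[OF k(1)]
      have "p \<noteq> 2" using odd[OF p] by auto
      hence p3: "p \<ge> 3" using prime_ge_2_nat[OF k(1)] by linarith
      have "p \<noteq> 4" "p \<noteq> 6" using odd[OF p] by auto
      then consider "p = 3" | "p = 5" | "p \<ge> 7" using p3 by linarith
      thus False
      proof cases
        case 1
        \<comment> \<open>For \<open>k = 0\<close> the candidates for \<open>m\<close> are 6, 9 and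
          12, of which only 9 is allowed.\<close>
        have "9 dvd m"
        proof (cases k)
          case 0
          have "apparition p = 2 \<or> apparition p = 3 \<or> apparition p = 4" using r 1 by auto
          thus ?thesis using k(2) m 0 1 by auto
        qed (use k 1 in auto)
        from totient[OF this] show False using Tp 1 by (intro contr[of 3 6]) (auto simp: power_divide)
      next
        case 2
        have t: "totient (15 :: nat) = 8" "totient (20 :: nat) = 8" "totient (25 :: nat) = 20"
          by code_simp+
        \<comment> \<open>For \<open>k = 0\<close> the ranks 2 to 6 give 10, 15, 20, 25 and 30 for
          \<open>m\<close>, and 10 is excluded.\<close>
        have "15 dvd m \<or> 20 dvd m \<or> 25 dvd m"
        proof (cases k)
          case 0
          have "apparition p \<in> {2, 3, 4, 5, 6}" using r 2 by auto
          thus ?thesis using k(2) m 0 2 by auto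
        qed (use k 2 in auto)
        hence "totient m \<ge> 8" using totient t by fastforce
        thus False using Tp 2 by (intro contr[of 5 6]) (auto simp: power_divide)
      next
        case 3
        have "p - 1 \<le> totient m" using totient[OF dvd[OF p]] totient_prime[OF k(1)] by simp
        \<comment> \<open>The inequality \<open>2 * p < (809 / 500) ^ (p - 1)\<close> fails at 5 and
          6 and holds from 7 on, hence the shift.\<close>
        moreover have "2 * (real n + 7) < (809 / 500) ^ (n + 6)" for n
        proof (induction n)
          case (Suc n)
          have "2 * (real (Suc n) + 7) \<le> (809 / 500) * (2 * (real n + 7))" by simp
          also have "\<dots> < (809 / 500) * (809 / 500) ^ (n + 6)" using Suc by simp
          also have "\<dots> = (809 / 500) ^ (Suc n + 6)" by (simp only: add_Suc power_Suc)
          finally show ?case .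
        qed (simp add: power_divide)
        from this[of "p - 7"] have "2 * real p < (809 / 500) ^ (p - 1)"
          using 3 by (simp add: of_nat_diff)
        ultimately show False using Tp by (intro contr[of p "p - 1"]) auto
      qed
    qed
  qed
qed

section \<open>Small ranks by explicit factorization\<close>

text \<open>The factors \<open>a ^ 4 + 5 * a\<^sup>2 + 5\<close> and
  \<open>a ^ 4 + 4 * a\<^sup>2 + 1\<close> are the parts of \<open>U 10\<close> and
  \<open>U 12\<close> in which primes of rank 10 and 12 are found.\<close>

lemma U_values: "U 2 = a" "U 3 = a\<^sup>2 + 1" "U 4 = a * (a\<^sup>2 + 2)" "U 5 = a ^ 4 + 3 * a\<^sup>2 + 1"
  "U 6 = a * (a\<^sup>2 + 1) * (a\<^sup>2 + 3)" "U 10 = U 5 * (a * (a ^ 4 + 5 * a\<^sup>2 + 5))"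
  "U 12 = U 6 * ((a\<^sup>2 + 2) * (a ^ 4 + 4 * a\<^sup>2 + 1))"
  by (simp_all add: numeral_eq_Suc algebra_simps)

lemma L_1: "L 1 = a"
  and L_3: "L 3 = a * (a\<^sup>2 + 3)"
  and L_5: "L 5 = a * (a ^ 4 + 5 * a\<^sup>2 + 5)"
  by (simp_all add: L_def numeral_eq_Suc algebra_simps)

text \<open>Fills in the ranks 4, 10 and 12 that \<open>ex_apparition\<close> omits. Above 3 the
  prime is automatically odd, since the rank of 2 is at most 3; rank 3 is treated directly.\<close>

lemma ex_apparition_odd:
  assumes m: "m > 2" "m \<noteq> 6" "a = 1 \<Longrightarrow> m \<notin> {3, 12}"
  shows "\<exists>p. prime p \<and> odd p \<and> apparition p = m"
proof -
  have two: "odd p" if "prime p" "apparition p = m" "m > 3" for p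
    using apparition_le_Suc[OF that(1)] that prime_odd_nat[of p] prime_ge_2_nat[of p] by (cases "p = 2") auto
  have eq: "p = q" if "prime p" "prime q" "p dvd q" for p q :: nat
    using that by (simp add: primes_dvd_imp_eq)
  consider "m = 3" | "m = 4" | "m = 10" | "m = 12" | "m > 3" "m \<notin> {4, 6, 10, 12}"
    using m by fastforce
  thus ?thesis
  proof cases
    case 1
    hence "a > 1" using m(3) a_pos by (cases "a = 1") auto
    hence "2\<^sup>2 \<le> a\<^sup>2" by (intro power_mono) auto
    then obtain p where p: "prime p" "p dvd a\<^sup>2 + 1" "p \<noteq> 2"
      using ex_prime_dvd_notin[of "{2}" "a\<^sup>2 + 1"] residues_quadratic[of a] by auto
    hence "p dvd U 3" by (simp add: U_values)
    hence "apparition p dvd 3" using p(1) prime_dvd_U_iff by simp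
    moreover have "prime (3 :: nat)" by simp
    ultimately have "apparition p = 3" using apparition_neq_1[OF p(1)] by (metis prime_nat_iff)
    thus ?thesis using p 1 prime_odd_nat prime_ge_2_nat[of p] by (intro exI[of _ p]) auto
  next
    case 2
    have "a\<^sup>2 > 0" using a_pos by simp
    then obtain p where p: "prime p" "p dvd a\<^sup>2 + 2" "p \<noteq> 2"
      using ex_prime_dvd_notin[of "{2}" "a\<^sup>2 + 2"] residues_quadratic[of a] by auto
    have "\<not> p dvd a"
    proof
      assume "p dvd a"
      hence "p dvd 2" using p(2) by (auto intro: dvd_add_cancel[of p "a\<^sup>2"] simp: power2_eq_square)
      thus False using eq[of p 2] p by simp
    qed
    hence "\<not> apparition p dvd 2" using p(1) prime_dvd_U_iff[of p 2] by (simp add: U_values)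
    moreover have "apparition p dvd 2 ^ 2"
      using p(2) prime_dvd_U_iff[OF p(1), of 4] unfolding U_values(3) by (simp del: distrib_left mult_Suc_right)
    ultimately have "apparition p = 4"
      unfolding divides_primepow_nat[OF two_is_prime_nat] by (auto simp: le_Suc_eq numeral_2_eq_2)
    thus ?thesis using p 2 two by auto
  next
    case 3
    have "a ^ 4 > 0" "a\<^sup>2 > 0" using a_pos by auto
    hence "a ^ 4 + 5 * a\<^sup>2 + 5 > 10" by linarith
    hence "\<exists>p. prime p \<and> p dvd a ^ 4 + 5 * a\<^sup>2 + 5 \<and> p \<notin> {2, 5}"
      using residues_biquadratic[of a] by (intro ex_prime_dvd_notin) auto
    then obtain p where p: "prime p" "p dvd a ^ 4 + 5 * a\<^sup>2 + 5" "p \<noteq> 2" "p \<noteq> 5" by auto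
    have dvd: "apparition p dvd 10"
      using dvd_mult[OF dvd_mult[OF p(2)]] prime_dvd_U_iff[OF p(1), of 10] unfolding U_values(6) by blast
    have "apparition p \<noteq> 2"
    proof
      assume "apparition p = 2"
      hence "p dvd a" using dvd_U_apparition[OF p(1)] by (simp add: U_values)
      hence "p dvd a ^ 4 + 5 * a\<^sup>2" by (simp add: numeral_eq_Suc)
      hence "p dvd 5" using p(2) dvd_add_cancel by blast
      thus False using eq[of p 5] p by simp
    qed
    moreover have "apparition p \<noteq> 5"
    proof
      assume "apparition p = 5"
      hence 5: "p dvd a ^ 4 + 3 * a\<^sup>2 + 1" using dvd_U_apparition[OF p(1)] by (simp add: U_values)
      have "a ^ 4 + 5 * a\<^sup>2 + 5 = (a ^ 4 + 3 * a\<^sup>2 + 1) + 2 * (a\<^sup>2 + 2)" by simp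
      hence "p dvd 2 * (a\<^sup>2 + 2)" using p(2) 5 dvd_add_cancel by metis
      hence "p dvd a\<^sup>2 + 2" using p(1,3) eq[of p 2] prime_dvd_mult_iff two_is_prime_nat by metis
      \<comment> \<open>This product is the chosen factor of \<open>U 10\<close> plus 1.\<close>
      hence "p dvd (a\<^sup>2 + 2) * (a\<^sup>2 + 3)" by (rule dvd_mult2)
      also have "(a\<^sup>2 + 2) * (a\<^sup>2 + 3) = (a ^ 4 + 5 * a\<^sup>2 + 5) + 1"
        by (simp add: algebra_simps numeral_eq_Suc)
      finally have "p dvd 1" using p(2) dvd_add_cancel by blast
      thus False using p(1) by simp
    qed
    moreover have "apparition p \<in> {1, 2, 5, 10}"
      using dvd_10[OF dvd] .
    ultimately have "apparition p = 10" using apparition_neq_1[OF p(1)] by simp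
    thus ?thesis using p 3 two by auto
  next
    case 4
    hence "a > 1" using m(3) a_pos by (cases "a = 1") auto
    hence "2\<^sup>2 \<le> a\<^sup>2" by (intro power_mono) auto
    hence "a ^ 4 + 4 * a\<^sup>2 + 1 > 6" by simp
    hence "\<exists>p. prime p \<and> p dvd a ^ 4 + 4 * a\<^sup>2 + 1 \<and> p \<notin> {2, 3}"
      using residues_biquadratic[of a] by (intro ex_prime_dvd_notin) auto
    then obtain p where p: "prime p" "p dvd a ^ 4 + 4 * a\<^sup>2 + 1" "p \<noteq> 2" "p \<noteq> 3" by auto
    have dvd: "apparition p dvd 12"
      using dvd_mult[OF dvd_mult[OF p(2)]] prime_dvd_U_iff[OF p(1), of 12] unfolding U_values(7) by blast
    have na: "\<not> p dvd a"
    proof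
      assume "p dvd a"
      hence "p dvd a ^ 4 + 4 * a\<^sup>2" by (simp add: numeral_eq_Suc)
      hence "p dvd 1" using p(2) dvd_add_cancel by blast
      thus False using p(1) by simp
    qed
    \<comment> \<open>The chosen factor of \<open>U 12\<close> differs from
      \<open>(a\<^sup>2 + 2)\<^sup>2\<close> by 3 and from
      \<open>(a\<^sup>2 + 1) * (a\<^sup>2 + 3)\<close> by 2, which is why the primes 2 and 3 were
      avoided.\<close>
    have n2: "\<not> p dvd a\<^sup>2 + 2"
    proof
      assume "p dvd a\<^sup>2 + 2"
      hence "p dvd (a\<^sup>2 + 2) * (a\<^sup>2 + 2)" by (rule dvd_mult2)
      also have "(a\<^sup>2 + 2) * (a\<^sup>2 + 2) = (a ^ 4 + 4 * a\<^sup>2 + 1) + 3"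
        by (simp add: algebra_simps numeral_eq_Suc)
      finally have "p dvd 3" using p(2) dvd_add_cancel by blast
      thus False using eq[of p 3] p by simp
    qed
    have n13: "\<not> p dvd (a\<^sup>2 + 1) * (a\<^sup>2 + 3)"
    proof
      assume "p dvd (a\<^sup>2 + 1) * (a\<^sup>2 + 3)"
      also have "(a\<^sup>2 + 1) * (a\<^sup>2 + 3) = (a ^ 4 + 4 * a\<^sup>2 + 1) + 2"
        by (simp add: algebra_simps numeral_eq_Suc)
      finally have "p dvd 2" using p(2) dvd_add_cancel by blast
      thus False using eq[of p 2] p by simp
    qed
    have "\<not> p dvd U 2" "\<not> p dvd U 3" "\<not> p dvd U 4" "\<not> p dvd U 6"
      using na n2 n13 unfolding U_values prime_dvd_mult_iff[OF p(1)] by blast+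
    hence "apparition p \<notin> {2, 3, 4, 6}" using dvd_U_apparition[OF p(1)] by auto
    moreover have "apparition p \<in> {1, 2, 3, 4, 6, 12}"
      using dvd_12[OF dvd] .
    ultimately have "apparition p = 12" using apparition_neq_1[OF p(1)] by simp
    thus ?thesis using p 4 two by auto
  next
    case 5
    thus ?thesis using ex_apparition[of m] two by auto
  qed
qed

text \<open>A ramified prime divides every \<open>\<Delta> (4 * k)\<close>, so it cannot be
  primitive beyond index 4. If odd, it equals its own rank; so the critical \<open>m\<close> are
  primes, where \<open>primitive_prime_index\<close> helps from 5 on and 3 is never
  ramified.\<close>

theorem ex_unramified_apparition:
  assumes m: "m > 2" "m \<noteq> 6" "a = 1 \<Longrightarrow> m \<notin> {3, 5, 12}"
  shows "\<exists>p. prime p \<and> odd p \<and> apparition p = m \<and> \<not> p dvd a\<^sup>2 + 4"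
proof (cases "prime m \<and> m \<ge> 5")
  case True
  then obtain p where p: "prime p" "apparition p = m" "\<not> p dvd a\<^sup>2 + 4"
    using primitive_prime_index m(3) by blast
  moreover have "odd p"
    using apparition_le_Suc[OF p(1)] p True prime_odd_nat[of p] prime_ge_2_nat[of p] by (cases "p = 2") auto
  ultimately show ?thesis by blast
next
  case False
  obtain p where p: "prime p" "odd p" "apparition p = m" using ex_apparition_odd m by auto
  have "\<not> p dvd a\<^sup>2 + 4"
  proof
    assume dvd: "p dvd a\<^sup>2 + 4"
    hence "m = p" using apparition_ramified p by simp
    moreover have "m \<noteq> 4" using p calculation by auto
    ultimately have "p = 3" using False p(1) m(1) by auto
    hence "3 dvd (a\<^sup>2 + 1) + 3" using dvd by (simp add: add.commute)
    hence "3 dvd a\<^sup>2 + 1" using dvd_add_left_iff[of 3 3 "a\<^sup>2 + 1"] by simp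
    thus False using residues_quadratic(4) by blast
  qed
  thus ?thesis using p by blast
qed

end

section \<open>The norm sequence\<close>

definition kept :: "nat set" where
  "kept = {n. n \<ge> 1 \<and> n mod 4 \<noteq> 2}"

lemma infinite_kept: "infinite kept"
proof -
  have "\<exists>n>m. n \<in> kept" for m by (intro exI[of _ "4 * m + 4"]) (auto simp: kept_def)
  thus ?thesis by (simp add: infinite_nat_iff_unbounded)
qed

text \<open>Counting from 0, \<open>(n + 2) div 3\<close> removed indices precede the kept index
  number \<open>n\<close>.\<close>

lemma enumerate_kept: "enumerate kept n = n + (n + 2) div 3 + 1"
proof (induction n)
  case 0
  have "(LEAST n. n \<in> kept) = 1" by (rule Least_equality) (auto simp: kept_def)
  thus ?case by (simp add: enumerate_0)
next
  case (Suc n)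
  show ?case
    unfolding enumerate_Suc''[OF infinite_kept] Suc
  proof (rule Least_equality)
    show "Suc n + (Suc n + 2) div 3 + 1 \<in> kept \<and> n + (n + 2) div 3 + 1 < Suc n + (Suc n + 2) div 3 + 1"
      unfolding kept_def mem_Collect_eq by presburger
    show "Suc n + (Suc n + 2) div 3 + 1 \<le> y" if "y \<in> kept \<and> n + (n + 2) div 3 + 1 < y" for y
    proof -
      define q where "q = n div 3"
      have y: "y mod 4 \<noteq> 2" "n + (n + 2) div 3 + 1 < y" using that by (auto simp: kept_def)
      consider "n = 3 * q" | "n = 3 * q + 1" | "n = 3 * q + 2" unfolding q_def by linarith
      thus ?thesis
      proof cases
        case 1
        \<comment> \<open>Only in this case is the number following the current index,
          \<open>4 * q + 2\<close>, a removed one.\<close>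
        have "y \<noteq> 4 * q + 2" using y(1) by presburger
        thus ?thesis using y(2) by (simp add: 1)
      qed (use y(2) in simp_all)
    qed
  qed
qed

section \<open>Primitive divisors of the norm sequence\<close>

context lucas
begin

text \<open>The expansion of \<open>(\<alpha> ^ n - 1) * (\<beta> ^ n - 1)\<close> with
  \<open>\<alpha> * \<beta> = -1\<close>.\<close>

definition \<Delta> :: "nat \<Rightarrow> int" where
  "\<Delta> n = (-1) ^ n + 1 - int (L n)"

lemma \<Delta>_odd: "odd n \<Longrightarrow> \<Delta> n = - int (L n)"
  by (simp add: \<Delta>_def)

lemma \<Delta>_4_times: "\<Delta> (4 * k) = - int ((a\<^sup>2 + 4) * U (2 * k) ^ 2)"
proof -
  have "4 * k = 2 * (2 * k)" by simp
  thus ?thesis unfolding \<Delta>_def by (simp only: L_double) simp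
qed

lemma kept_cases:
  assumes "n \<in> kept"
  obtains "odd n" | k where "k > 0" "n = 4 * k"
proof (cases "odd n")
  case False
  hence "4 dvd n" using assms unfolding kept_def mem_Collect_eq by presburger
  moreover have "n > 0" using assms by (simp add: kept_def)
  ultimately show ?thesis using that(2) by (auto elim!: dvdE)
qed (use that in auto)

lemma \<Delta>_neq_0: "n \<in> kept \<Longrightarrow> \<Delta> n \<noteq> 0"
  by (erule kept_cases) (use L_pos[of n] in \<open>auto simp: \<Delta>_odd \<Delta>_4_times simp del: of_nat_mult of_nat_add\<close>)

lemma prime_dvd_\<Delta>_odd: "odd n \<Longrightarrow> int p dvd \<Delta> n \<longleftrightarrow> p dvd L n"
  by (simp add: \<Delta>_odd)

lemma prime_dvd_\<Delta>_4_times: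
  "prime p \<Longrightarrow> int p dvd \<Delta> (4 * k) \<longleftrightarrow> p dvd a\<^sup>2 + 4 \<or> p dvd U (2 * k)"
  unfolding \<Delta>_4_times dvd_minus_iff of_nat_dvd_iff by (simp add: prime_dvd_mult_iff prime_dvd_power_iff)

text \<open>Works with the original indices instead of positions in \<open>Delta'\<close>; all kept
  terms are nonzero by \<open>\<Delta>_neq_0\<close>.\<close>

definition primitive :: "nat \<Rightarrow> int \<Rightarrow> bool" where
  "primitive n p \<longleftrightarrow> prime p \<and> p dvd \<Delta> n \<and> (\<forall>j\<in>kept. j < n \<longrightarrow> \<not> p dvd \<Delta> j)"

lemma primitiveI:
  assumes p: "prime p" and "int p dvd \<Delta> n"
    and "\<And>j. odd j \<Longrightarrow> j < n \<Longrightarrow> \<not> p dvd L j"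
    and "\<And>i. i > 0 \<Longrightarrow> 4 * i < n \<Longrightarrow> \<not> p dvd a\<^sup>2 + 4 \<and> \<not> p dvd U (2 * i)"
  shows "primitive n (int p)"
proof -
  have "\<not> int p dvd \<Delta> j" if "j \<in> kept" "j < n" for j
    using that(1)
  proof (cases rule: kept_cases)
    case 1
    thus ?thesis using assms(3)[OF 1 that(2)] by (simp add: prime_dvd_\<Delta>_odd)
  next
    case (2 k)
    thus ?thesis using assms(4)[of k] that(2) by (simp add: prime_dvd_\<Delta>_4_times[OF p])
  qed
  thus ?thesis using assms(1,2) by (simp add: primitive_def)
qed

lemma dvd_L_imp_apparition_dvd: "prime p \<Longrightarrow> p dvd L j \<Longrightarrow> apparition p dvd 2 * j"
  using prime_dvd_U_iff[of p "2 * j"] by (simp add: U_double)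

text \<open>For \<open>a = 1\<close> the ranks 3, 5 and 12 barred in
  \<open>ex_unramified_apparition\<close> correspond to the indices 12, 20 and 24. The indices 1, 3
  and 4 would call for the ranks 2, 6 and 1, outside that theorem, and are treated by hand.\<close>

lemma ex_primitive:
  assumes "n \<in> kept" "a = 1 \<Longrightarrow> n \<notin> {1, 12, 20, 24}" "a = 2 \<Longrightarrow> n \<noteq> 4"
  shows "\<exists>p. primitive n p"
  using assms(1)
proof (cases rule: kept_cases)
  case 1
  have "n = 1 \<or> n = 3 \<or> n \<ge> 5" using 1 by presburger
  then consider "n = 1" | "n = 3" | "n \<ge> 5" by blast
  thus ?thesis
  proof cases
    case n: 1
    hence "a \<noteq> 1" using assms(2) by auto
    then obtain p where p: "prime p" "p dvd a" using prime_factor_nat by blast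
    have "primitive n (int p)"
      using p n by (intro primitiveI) (auto simp: prime_dvd_\<Delta>_odd L_1[simplified])
    thus ?thesis by blast
  next
    case n: 2
    have "a\<^sup>2 > 0" using a_pos by simp
    hence "\<exists>p. prime p \<and> p dvd a\<^sup>2 + 3 \<and> p \<notin> {3}"
      using residues_quadratic[of a] by (intro ex_prime_dvd_notin) auto
    then obtain p where p: "prime p" "p dvd a\<^sup>2 + 3" "p \<noteq> 3" by auto
    have na: "\<not> p dvd a"
    proof
      assume "p dvd a"
      hence "p dvd a\<^sup>2" by (simp add: power2_eq_square)
      hence "p dvd 3" using p(2) dvd_add_cancel by blast
      thus False using p primes_dvd_imp_eq[of p 3] by simp
    qed
    have "primitive n (int p)"
    proof (rule primitiveI[OF p(1)])
      show "int p dvd \<Delta> n" unfolding n prime_dvd_\<Delta>_odd[of 3, simplified] L_3 using p(2) by (rule dvd_mult)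
      fix j :: nat assume "odd j" "j < n"
      hence "j = 1" using n by presburger
      thus "\<not> p dvd L j" using na by (simp add: L_1[simplified])
    qed (use n in auto)
    thus ?thesis by blast
  next
    case n: 3
    have "a = 1 \<Longrightarrow> 2 * n \<notin> {3, 5, 12}" using 1 by (auto; presburger)
    moreover have "2 * n > 2" "2 * n \<noteq> 6" using n by auto
    ultimately obtain p where p: "prime p" "apparition p = 2 * n" "\<not> p dvd a\<^sup>2 + 4"
      using ex_unramified_apparition[of "2 * n"] by blast
    have "p dvd U (2 * n)" "\<not> p dvd U n" using p n prime_dvd_U_iff by (auto dest: dvd_imp_le)
    hence "p dvd L n" using p(1) by (simp add: U_double prime_dvd_mult_iff)
    have "primitive n (int p)"
    proof (rule primitiveI[OF p(1)])
      show "int p dvd \<Delta> n" using \<open>p dvd L n\<close> 1 by (simp add: prime_dvd_\<Delta>_odd)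
      show "\<not> p dvd L j" if j: "odd j" "j < n" for j
      proof
        assume "p dvd L j"
        hence "2 * n dvd 2 * j" using dvd_L_imp_apparition_dvd p by metis
        hence "2 * n \<le> 2 * j" using j odd_pos[OF j(1)] by (intro dvd_imp_le) auto
        thus False using j by simp
      qed
      show "\<not> p dvd a\<^sup>2 + 4 \<and> \<not> p dvd U (2 * i)" if "i > 0" "4 * i < n" for i
        using p prime_dvd_U_iff[OF p(1), of "2 * i"] that by (auto dest: dvd_imp_le)
    qed
    thus ?thesis by blast
  qed
next
  case (2 k)
  have "k = 1 \<or> odd k \<and> k \<ge> 3 \<or> even k" using 2(1) by presburger
  then consider "k = 1" | "odd k" "k \<ge> 3" | "even k" by blast
  thus ?thesis
  proof cases
    case k: 1
    \<comment> \<open>As \<open>\<Delta> 4 = - (a\<^sup>2 + 4) * a\<^sup>2\<close> and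
      \<open>\<Delta> 1 = - a\<close>, a primitive prime has to be ramified. An odd one exists
      unless \<open>a\<^sup>2 + 4\<close> is a power of 2, which happens only for
      \<open>a = 2\<close>.\<close>
    have "\<exists>p. prime p \<and> odd p \<and> p dvd a\<^sup>2 + 4"
    proof (cases "even a")
      case True
      then obtain b where b: "a = 2 * b" by blast
      hence "b > 1" using a_pos assms(3) 2 k by (cases "b = 1") auto
      hence "2\<^sup>2 \<le> b\<^sup>2" by (intro power_mono) auto
      hence "\<exists>p. prime p \<and> p dvd b\<^sup>2 + 1 \<and> p \<notin> {2}"
        using residues_quadratic[of b] by (intro ex_prime_dvd_notin) auto
      then obtain p where p: "prime p" "p dvd b\<^sup>2 + 1" "p \<noteq> 2" by auto
      have "a\<^sup>2 + 4 = 4 * (b\<^sup>2 + 1)" by (simp add: b)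
      hence "p dvd a\<^sup>2 + 4" using p(2) by (metis dvd_mult)
      thus ?thesis using p prime_odd_nat prime_ge_2_nat[of p] by (intro exI[of _ p]) auto
    next
      case False
      obtain p where p: "prime p" "p dvd a\<^sup>2 + 4"
        using prime_factor_nat[of "a\<^sup>2 + 4"] by auto
      moreover have "odd (a\<^sup>2 + 4)" using False by simp
      ultimately show ?thesis using dvd_trans by blast
    qed
    then obtain p where p: "prime p" "odd p" "p dvd a\<^sup>2 + 4" by blast
    have "primitive n (int p)"
    proof (rule primitiveI[OF p(1)])
      show "int p dvd \<Delta> n" using p(1,3) 2 by (simp add: prime_dvd_\<Delta>_4_times)
      have na: "\<not> p dvd a"
      proof
        assume "p dvd a"
        hence "p dvd a\<^sup>2" by (simp add: power2_eq_square)
        hence "p dvd 2\<^sup>2" using p(3) dvd_add_cancel[of p "a\<^sup>2" 4] by simp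
        hence "p dvd 2" using p(1) prime_dvd_power by blast
        thus False using p(1,2) primes_dvd_imp_eq[of p 2] by simp
      qed
      have n3: "\<not> p dvd a\<^sup>2 + 3"
        using p(1,3) dvd_add_cancel[of p "a\<^sup>2 + 3" 1] by (auto simp: numeral_eq_Suc)
      fix j :: nat assume "odd j" "j < n"
      hence "j = 1 \<or> j = 3" using 2 k by (auto elim!: oddE)
      thus "\<not> p dvd L j"
      proof
        assume "j = 3"
        thus ?thesis using na n3 by (simp only: L_3 prime_dvd_mult_iff[OF p(1)]) simp
      qed (use na in \<open>simp add: L_1[simplified]\<close>)
    qed (use 2 k in auto)
    thus ?thesis by blast
  next
    case k: 2
    have "a = 1 \<Longrightarrow> k \<notin> {3, 5, 12}" using assms(2) 2 k by auto
    moreover have "k > 2" "k \<noteq> 6" using k by auto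
    ultimately obtain p where p: "prime p" "odd p" "apparition p = k" "\<not> p dvd a\<^sup>2 + 4"
      using ex_unramified_apparition[of k] by blast
    have "primitive n (int p)"
    proof (rule primitiveI[OF p(1)])
      show "int p dvd \<Delta> n" using p 2 by (simp add: prime_dvd_\<Delta>_4_times prime_dvd_U_iff)
      \<comment> \<open>As \<open>k\<close> is odd, \<open>k dvd 2 * j\<close> makes
        \<open>p\<close> divide both \<open>U j\<close> and \<open>L j\<close>; this is where the
        oddness of \<open>p\<close> enters.\<close>
      show "\<not> p dvd L j" if j: "odd j" "j < n" for j
      proof
        assume L: "p dvd L j"
        hence "k dvd 2 * j" using dvd_L_imp_apparition_dvd p by metis
        moreover have "coprime k 2" using k(1) by simp
        ultimately have "k dvd j" by (simp add: coprime_dvd_mult_right_iff)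
        hence "p dvd U j" using p prime_dvd_U_iff by simp
        thus False using prime_dvd_U_L[OF p(1) _ L] p(2) by auto
      qed
      show "\<not> p dvd a\<^sup>2 + 4 \<and> \<not> p dvd U (2 * i)" if i: "i > 0" "4 * i < n" for i
      proof -
        have "\<not> k dvd i" using i 2 by (auto dest: dvd_imp_le)
        moreover have "coprime k 2" using k(1) by simp
        ultimately have "\<not> k dvd 2 * i" by (simp add: coprime_dvd_mult_right_iff)
        thus ?thesis using p prime_dvd_U_iff by simp
      qed
    qed
    thus ?thesis by blast
  next
    case k: 3
    have "a = 1 \<Longrightarrow> 2 * k \<notin> {3, 5, 12}" using assms(2) 2 by (auto; presburger)
    moreover have "2 * k > 2" "2 * k \<noteq> 6" using k 2(1) by presburger+
    ultimately obtain p where p: "prime p" "apparition p = 2 * k" "\<not> p dvd a\<^sup>2 + 4"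
      using ex_unramified_apparition[of "2 * k"] by blast
    have "primitive n (int p)"
    proof (rule primitiveI[OF p(1)])
      show "int p dvd \<Delta> n" using p 2 by (simp add: prime_dvd_\<Delta>_4_times prime_dvd_U_iff)
      show "\<not> p dvd L j" if j: "odd j" "j < n" for j
      proof
        assume "p dvd L j"
        hence "2 * k dvd 2 * j" using dvd_L_imp_apparition_dvd p by metis
        hence "k dvd j" by simp
        thus False using k j(1) dvd_trans by blast
      qed
      show "\<not> p dvd a\<^sup>2 + 4 \<and> \<not> p dvd U (2 * i)" if "i > 0" "4 * i < n" for i
        using p prime_dvd_U_iff[OF p(1), of "2 * i"] that 2 by (auto dest: dvd_imp_le)
    qed
    thus ?thesis by blast
  qed
qed

lemma not_primitiveI:
  assumes "\<And>p :: int. prime p \<Longrightarrow> p dvd \<Delta> n \<Longrightarrow> \<exists>j\<in>kept. j < n \<and> p dvd \<Delta> j"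
  shows "\<not> (\<exists>p. primitive n p)"
  using assms by (auto simp: primitive_def)

lemma not_primitive_silver:
  assumes "a = 2"
  shows "\<not> (\<exists>p. primitive 4 p)"
proof (rule not_primitiveI)
  fix p :: int assume p: "prime p" "p dvd \<Delta> 4"
  have "\<Delta> 4 = - (2 ^ 5)"
    using \<Delta>_4_times[of 1] U_values(1) assms by simp
  hence "p dvd 2 ^ 5" using p(2) by (simp only: dvd_minus_iff)
  hence "p dvd 2" using p(1) prime_dvd_power by blast
  hence "p dvd \<Delta> 1" using \<Delta>_odd[of 1] L_1 assms by simp
  thus "\<exists>j\<in>kept. j < 4 \<and> p dvd \<Delta> j" by (intro bexI[of _ 1]) (auto simp: kept_def)
qed

lemma not_primitive_golden:
  assumes "a = 1" "n \<in> {1, 12, 20, 24}"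
  shows "\<not> (\<exists>p. primitive n p)"
proof (rule not_primitiveI)
  fix p :: int assume p: "prime p" "p dvd \<Delta> n"
  have U: "U 2 = 1" "U 4 = 3" "U 6 = 8" "U 10 = 55" "U 12 = 144"
    unfolding U_values by (simp_all add: assms(1))
  have L: "L 1 = 1" "L 3 = 4" "L 5 = 11"
    unfolding L_1 L_3 L_5 by (simp_all add: assms(1))
  \<comment> \<open>Every prime in the factorizations at 12, 20 and 24 already divides a term at 3,
    4, 5 or 8; the term at 1 is a unit.\<close>
  have \<Delta>: "\<Delta> 1 = - 1" "\<Delta> 3 = - 4" "\<Delta> 4 = - 5" "\<Delta> 5 = - 11" "\<Delta> 8 = - 45"
    "\<Delta> 12 = - (2 ^ 6 * 5)" "\<Delta> 20 = - (5 ^ 3 * 11 ^ 2)" "\<Delta> 24 = - (2 ^ 8 * 3 ^ 4 * 5)"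
    using \<Delta>_odd[of 1] \<Delta>_odd[of 3] \<Delta>_odd[of 5] L U assms(1) \<Delta>_4_times[of 1] \<Delta>_4_times[of 2]
      \<Delta>_4_times[of 3] \<Delta>_4_times[of 5] \<Delta>_4_times[of 6] by simp_all
  have kept: "{3, 4, 5, 8} \<subseteq> kept" by (auto simp: kept_def)
  have "\<exists>j\<in>{3, 4, 5, 8}. j < n \<and> p dvd \<Delta> j"
    using assms(2)
  proof (elim insertE emptyE)
    assume "n = 1"
    hence "p dvd 1" using p(2) \<Delta>(1) by simp
    thus ?thesis using p(1) not_prime_unit by blast
  next
    assume n: "n = 12"
    have "p dvd 2 ^ 6 * 5" using p(2) unfolding n \<Delta> dvd_minus_iff .
    hence "p dvd 2 \<or> p dvd 5" using p(1) by (metis prime_dvd_mult_iff prime_dvd_power)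
    moreover have "(2 :: int) dvd 4" by simp
    ultimately show ?thesis unfolding n by (auto simp: \<Delta> intro: dvd_trans)
  next
    assume n: "n = 20"
    have "p dvd 5 ^ 3 * 11 ^ 2" using p(2) unfolding n \<Delta> dvd_minus_iff .
    hence "p dvd 5 \<or> p dvd 11" using p(1) by (metis prime_dvd_mult_iff prime_dvd_power)
    thus ?thesis unfolding n by (auto simp: \<Delta>)
  next
    assume n: "n = 24"
    have "p dvd 2 ^ 8 * 3 ^ 4 * 5" using p(2) unfolding n \<Delta> dvd_minus_iff .
    hence "p dvd 2 \<or> p dvd 3 \<or> p dvd 5" using p(1) by (metis prime_dvd_mult_iff prime_dvd_power)
    moreover have "(2 :: int) dvd 4" "(3 :: int) dvd 45" by simp_all
    ultimately show ?thesis unfolding n by (auto simp: \<Delta> intro: dvd_trans)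
  qed
  thus "\<exists>j\<in>kept. j < n \<and> p dvd \<Delta> j" using kept by blast
qed

text \<open>The enumeration of \<open>kept\<close> is an order isomorphism, so primitivity at
  position \<open>k\<close> is \<open>primitive\<close> at \<open>e k\<close>; the exceptional
  positions are then read off from \<open>enumerate_kept\<close>.\<close>

lemma no_primitive_iff:
  assumes "\<And>n. Delta d u n = \<Delta> n"
  shows "k \<in> no_primitive (Delta' d u) \<longleftrightarrow> k \<ge> 1 \<and>
    ((a = 1 \<and> k \<in> {1, 9, 15, 18}) \<or> (a = 2 \<and> k = 3))"
proof (cases "k \<ge> 1")
  case True
  define e where "e = (\<lambda>k. enumerate kept (k - 1))"
  have Delta': "Delta' d u j = \<Delta> (e j)" for j
    unfolding Delta'_def kept_def[symmetric] assms e_def ..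
  have e: "e j \<in> kept" for j unfolding e_def by (rule enumerate_in_set[OF infinite_kept])
  have mono: "e i < e j \<longleftrightarrow> i < j" if "i \<ge> 1" "j \<ge> 1" for i j
    using that unfolding e_def enumerate_mono_iff[OF infinite_kept] by linarith
  have surj: "\<exists>j\<ge>1. n = e j" if n: "n \<in> kept" for n
  proof -
    obtain j where "enumerate kept j = n" using enumerate_Ex[OF infinite_kept n] by blast
    thus ?thesis by (intro exI[of _ "Suc j"]) (simp add: e_def)
  qed
  have "primitive_prime_divisor (Delta' d u) k p \<longleftrightarrow> primitive (e k) p" for p
    unfolding primitive_prime_divisor_def primitive_def Delta'
    using e mono[OF _ True] surj \<Delta>_neq_0 by metis
  hence "k \<in> no_primitive (Delta' d u) \<longleftrightarrow> \<not> (\<exists>p. primitive (e k) p)"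
    using True by (simp add: no_primitive_def)
  also have "\<dots> \<longleftrightarrow> (a = 1 \<and> e k \<in> {1, 12, 20, 24}) \<or> (a = 2 \<and> e k = 4)"
    using ex_primitive[OF e, of k] not_primitive_silver not_primitive_golden[of "e k"] by auto
  also have "\<dots> \<longleftrightarrow> (a = 1 \<and> k \<in> {1, 9, 15, 18}) \<or> (a = 2 \<and> k = 3)"
  proof -
    have ek: "e 1 = 1" "e 3 = 4" "e 9 = 12" "e 15 = 20" "e 18 = 24"
      by (simp_all add: e_def enumerate_kept)
    have inj: "e k = e j \<longleftrightarrow> k = j" if "j \<ge> 1" for j
      using mono[OF True that] mono[OF that True] by (metis less_irrefl linorder_neqE_nat)
    have "e k = 1 \<longleftrightarrow> k = 1" "e k = 4 \<longleftrightarrow> k = 3" "e k = 12 \<longleftrightarrow> k = 9" "e k = 20 \<longleftrightarrow> k = 15"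
      "e k = 24 \<longleftrightarrow> k = 18"
      using inj[of 1] inj[of 3] inj[of 9] inj[of 15] inj[of 18] unfolding ek by simp_all
    thus ?thesis by simp
  qed
  finally show ?thesis using True by simp
qed (simp add: no_primitive_def)

end

section \<open>From the quadratic unit to the Lucas sequence\<close>

text \<open>Here \<open>v\<close> is the conjugate of \<open>u\<close>. Conjugation respects powers,
  so the norm of \<open>u ^ n - 1\<close> is \<open>(u ^ n - 1) * (v ^ n - 1)\<close>.\<close>

lemma quad_unit_trace:
  assumes d: "d > 1" "squarefree d" and u: "u \<in> quad_units d" "quad_norm d u = -1"
  obtains v where "u * v = -1" "\<And>n. real_of_int (Delta d u n) = (-1) ^ n + 1 - (u ^ n + v ^ n)"
proof -
  obtain x y where xy: "u = x + y * sqrt (of_int d)" "x \<in> \<rat>" "y \<in> \<rat>"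
    using u(1) by (auto simp: quad_units_def quad_integers_def quad_field_def)
  define s where "s = sqrt (of_int d)"
  have s: "s * s = of_int d" using d by (simp add: s_def)
  define v where "v = x - y * s"
  have uv: "u * v = -1"
    using u(2) quad_conj_eq[OF d xy(2,3)] unfolding quad_norm_def xy(1) v_def s_def by simp
  have pow: "\<exists>X\<in>\<rat>. \<exists>Y\<in>\<rat>. u ^ n = X + Y * s \<and> v ^ n = X - Y * s" for n
  proof (induction n)
    case 0
    show ?case by (intro bexI[of _ 1] bexI[of _ 0]) auto
  next
    case (Suc n)
    then obtain X Y where XY: "X \<in> \<rat>" "Y \<in> \<rat>" "u ^ n = X + Y * s" "v ^ n = X - Y * s" by blast
    have e: "y * s * (Y * s) = y * Y * of_int d" unfolding s[symmetric] by simp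
    have "u ^ Suc n = (x * X + y * Y * of_int d) + (x * Y + y * X) * s"
      "v ^ Suc n = (x * X + y * Y * of_int d) - (x * Y + y * X) * s"
      unfolding power_Suc XY(3,4) e[symmetric] unfolding xy(1) v_def s_def
      by (simp_all add: algebra_simps)
    moreover have "x * X + y * Y * of_int d \<in> \<rat>" "x * Y + y * X \<in> \<rat>"
      using xy(2,3) XY(1,2) by auto
    ultimately show ?case by blast
  qed
  have "real_of_int (Delta d u n) = (-1) ^ n + 1 - (u ^ n + v ^ n)" for n
  proof -
    obtain X Y where XY: "X \<in> \<rat>" "Y \<in> \<rat>" "u ^ n = X + Y * s" "v ^ n = X - Y * s" using pow by blast
    have "u ^ n - 1 = (X - 1) + Y * sqrt (of_int d)" by (simp add: XY(3) s_def)
    hence "quad_conj d (u ^ n - 1) = (X - 1) - Y * sqrt (of_int d)"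
      using XY by (simp only:) (intro quad_conj_eq[OF d]; auto)
    hence "quad_norm d (u ^ n - 1) = (u ^ n - 1) * (v ^ n - 1)"
      by (simp add: quad_norm_def XY(4) s_def)
    also have "\<dots> = (u * v) ^ n + 1 - (u ^ n + v ^ n)" by (simp add: algebra_simps power_mult_distrib)
    finally show ?thesis using of_int_Delta[OF d u(1)] uv by simp
  qed
  thus ?thesis using that uv by blast
qed

theorem theorem3p2:
  fixes d :: int and u :: real
  assumes "d > 1" and "squarefree d"
    and "u \<in> quad_units d" and "quad_norm d u = -1" and "u > 1"
  shows "(u > 13 \<longrightarrow> zsigmondy_bound (Delta' d u) \<le> 4) \<and>
    (u \<le> 13 \<longrightarrow>
       (u = 1 + sqrt 2 \<and> zsigmondy_bound (Delta' d u) = 3 \<and>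
          no_primitive (Delta' d u) = {3}) \<or>
       (u = (1 + sqrt 5) / 2 \<and> zsigmondy_bound (Delta' d u) = 18 \<and>
          {k \<in> no_primitive (Delta' d u). k > 1} = {9, 15, 18}) \<or>
       zsigmondy_bound (Delta' d u) = 1)"
proof -
  obtain v where uv: "u * v = -1"
    and Delta: "\<And>n. real_of_int (Delta d u n) = (-1) ^ n + 1 - (u ^ n + v ^ n)"
    using quad_unit_trace[OF assms(1-4)] by blast
  have v: "v = - 1 / u" using uv assms(5) by (simp add: field_simps)
  \<comment> \<open>The trace is an integer because it is \<open>- Delta d u 1\<close>, and positive
    because \<open>u > 1\<close> and \<open>v = - 1 / u\<close>.\<close>
  have "real_of_int (- Delta d u 1) = u + v" using Delta[of 1] by simp
  moreover have "u + v > 0" using assms(5) by (simp add: v field_simps) (smt (verit) mult_less_cancel_right2)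
  ultimately obtain a :: nat where a: "real a = u + v" "a > 0"
    by (metis of_int_0_less_iff of_int_of_nat_eq of_nat_0_less_iff zero_less_imp_eq_int)
  interpret lucas a by standard (rule a(2))
  \<comment> \<open>\<open>u\<close> and \<open>\<alpha>\<close> are positive roots of the same
    quadratic polynomial, whose other root \<open>\<beta>\<close> is negative.\<close>
  have "(u - \<alpha>) * (u - \<beta>) = u\<^sup>2 - (\<alpha> + \<beta>) * u + \<alpha> * \<beta>"
    by (simp add: algebra_simps power2_eq_square)
  also have "\<dots> = 0" unfolding \<alpha>_plus_\<beta> \<alpha>_times_\<beta> a(1) using uv by (simp add: algebra_simps power2_eq_square)
  finally have "u = \<alpha> \<or> u = \<beta>" by simp
  moreover have "\<beta> < 0" using \<alpha>_times_\<beta> \<alpha>_pos by (smt (verit) mult_nonneg_nonneg)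
  ultimately have u: "u = \<alpha>" using assms(5) by auto
  hence "v = \<beta>" using a(1) \<alpha>_plus_\<beta> by simp
  have "real_of_int (Delta d u n) = real_of_int (\<Delta> n)" for n
    using Delta[of n] L_Binet[of n] by (simp add: \<Delta>_def u \<open>v = \<beta>\<close>)
  hence "Delta d u n = \<Delta> n" for n using of_int_eq_iff by blast
  hence np: "k \<in> no_primitive (Delta' d u) \<longleftrightarrow> k \<ge> 1 \<and>
    ((a = 1 \<and> k \<in> {1, 9, 15, 18}) \<or> (a = 2 \<and> k = 3))" for k
    by (rule no_primitive_iff)
  consider "a = 1" | "a = 2" | "a \<ge> 3" using a(2) by linarith
  thus ?thesis
  proof cases
    case 1
    \<comment> \<open>Position 1 belongs to the set because \<open>\<Delta> 1 = -1\<close> has no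
      prime divisor.\<close>
    have np: "no_primitive (Delta' d u) = {1, 9, 15, 18}"
      by (rule set_eqI, unfold np) (use 1 in force)
    have "u = (1 + sqrt 5) / 2" unfolding u \<alpha>_def by (simp add: 1)
    moreover have "zsigmondy_bound (Delta' d u) = 18"
      by (simp add: zsigmondy_bound_def np numeral_eq_enat)
    moreover have "{k \<in> no_primitive (Delta' d u). k > 1} = {9, 15, 18}" unfolding np by auto
    \<comment> \<open>This gives \<open>u \<le> 2\<close>, so the implication for
      \<open>u > 13\<close> is vacuous here.\<close>
    moreover have "sqrt 5 \<le> 3" by (rule real_le_lsqrt) auto
    ultimately show ?thesis by simp
  next
    case 2
    have np: "no_primitive (Delta' d u) = {3}"
      by (rule set_eqI, unfold np) (use 2 in force)
    have "sqrt (4 * 2) = sqrt 4 * sqrt (2 :: real)" by (rule real_sqrt_mult)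
    hence s8: "sqrt 8 = 2 * sqrt (2 :: real)" by simp
    have "u = 1 + sqrt 2" unfolding u \<alpha>_def by (simp add: 2 s8)
    moreover have "zsigmondy_bound (Delta' d u) = 3"
      by (simp add: zsigmondy_bound_def np numeral_eq_enat)
    moreover have "sqrt 2 \<le> 3" by (rule real_le_lsqrt) auto
    ultimately show ?thesis using np by simp
  next
    case 3
    \<comment> \<open>With no exceptional position, the convention for the empty set gives the bound
      1, which settles both ranges of \<open>u\<close>.\<close>
    hence "no_primitive (Delta' d u) = {}"
      by (intro set_eqI, unfold np) force
    hence "zsigmondy_bound (Delta' d u) = 1" by (simp add: zsigmondy_bound_def)
    thus ?thesis by simp
  qed
qed

end
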